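(* Let $Q$ be a set endowed with a binary operation $\lhd$ and a unary operation $\varsigma\colon a\mapsto a^2$. Consider the following $Q$-coloring rules for diagrams of well-oriented knotted $3$-valent graphs. (A) At each crossing, if the over-arc has color $b$ and the under-arc lying to the right of the over-arc (with respect to the orientation of the over-arc) has color $a$, then the under-arc lying to the left of the over-arc has color $a\lhd b$. (C) At each zip vertex the two incoming arcs have the same color $a$ and the outgoing arc has color $a^2$; at each unzip vertex the two outgoing arcs have the same color $a$ and the incoming arc has color $a^2$. These coloring rules are topological if and only if $(Q,\lhd,\varsigma)$ is a squandle.
   Context: **Graphs and diagrams.** A knotted $3$-valent graph is an embedding of an abstract $3$-valent graph into $\mathbb{R}^3$; diagrams are its generic projections to $\mathbb{R}^2$ with over/under information at crossings. An oriented $3$-valent graph is well-oriented if each vertex is a zip vertex (two incoming edges, one outgoing) or an unzip vertex (one incoming edge, two outgoing). The special points of a diagram are its crossings and its $3$-valent vertices. An arc is a part of the diagram delimited by special points, where the over-strand is not cut at a crossing (so it carries one color through the crossing). A sub-diagram is a part of a diagram contained in a disc, e.g. either side of an R-move. **R-moves.** These are the local moves: I, II, III (the usual Reidemeister moves); IV (a strand passing under a $3$-valent vertex is moved from one side of the vertex to the other); V (a crossing between two edges adjacent to a vertex, located next to this vertex, is added or removed); VI (a strand passing over a $3$-valent vertex is moved from one side of the vertex to the other). All these moves are considered with all orientations for which the diagrams involved are well-oriented. **Colorings.** For a set $Q$ with coloring rules, a $Q$-coloring of a (sub-)diagram $D$ is a map from the set of arcs of $D$ to $Q$ satisfying the coloring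 rules around all special points. Coloring rules are called topological if for any (sub-)diagram $D$, any $Q$-coloring $\mathcal{C}$ of $D$, and any $D'$ obtained from $D$ by applying one R-move, there exists a unique $Q$-coloring $\mathcal{C}'$ of $D'$ coinciding with $\mathcal{C}$ outside the small ball where the R-move is performed. **Squandles.** $(Q,\lhd,\varsigma)$ is a squandle if there is a (necessarily unique) binary operation $\widetilde{\lhd}$ on $Q$ such that for all $a,b,c\in Q$: $(a\lhd b)\lhd c=(a\lhd c)\lhd(b\lhd c)$; $(a\lhd b)\,\widetilde{\lhd}\, b=(a\,\widetilde{\lhd}\, b)\lhd b=a$; $a\lhd a=a$; $a\lhd b^2=(a\lhd b)\lhd b$; $a^2\lhd b=(a\lhd b)^2$. *)

theory Defs
  imports "HOL-Library.FuncSet"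
begin

text \<open>
  Diagrams are taken up to planar isotopy and written as movies. A (sub-)diagram in a disc is moved
  into a rectangle with its free ends on the bottom and top sides, and into general position with
  respect to the height function; it is then read from bottom to top as a list of signed points
  (the bottom ends) followed by layers, each containing exactly one elementary piece and otherwise
  vertical strands. Conversely, every such movie is a part of a closed diagram, whatever the signs of
  its ends: an end leading out of (into) the rectangle can be continued to a zip (unzip) vertex
  whose two other legs form a small loop.
\<close>

datatype dir = Up | Down

fun opp :: "dir \<Rightarrow> dir" where
  "opp Up = Down"
| "opp Down = Up"

text \<open>
  The arguments give the orientations of the strands. \<open>Cup\<close> and \<open>Cap\<close> carry the
  orientation of their left leg. In \<open>Cross ov d e\<close> the strand of orientation \<open>d\<close> runs
  between bottom left and top right, the one of orientation \<open>e\<close> between bottom right and top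
  left, and \<open>ov\<close> says that the former passes over the latter. \<open>Merge\<close> and \<open>Split\<close>
  are 3-valent vertices with two legs below and one above, respectively one below and two above;
  legs on the same side are listed from left to right.
\<close>

datatype piece =
    Cup dir
  | Cap dir
  | Cross bool dir dir
  | Merge dir dir dir
  | Split dir dir dir

fun source :: "piece \<Rightarrow> dir list" where
  "source (Cup d) = []"
| "source (Cap d) = [d, opp d]"
| "source (Cross ov d e) = [d, e]"
| "source (Merge d e f) = [d, e]"
| "source (Split d e f) = [d]"

fun target :: "piece \<Rightarrow> dir list" where
  "target (Cup d) = [d, opp d]"
| "target (Cap d) = []"
| "target (Cross ov d e) = [e, d]"
| "target (Merge d e f) = [f]"
| "target (Split d e f) = [e, f]"

text \<open>
  For each leg of a vertex, in counterclockwise order, whether it is outgoing. A zip vertex has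
  exactly one outgoing leg, an unzip vertex exactly two.
\<close>

fun outgoing_legs :: "piece \<Rightarrow> bool list" where
  "outgoing_legs (Merge d e f) = [d = Down, e = Down, f = Up]"
| "outgoing_legs (Split d e f) = [d = Down, f = Up, e = Up]"
| "outgoing_legs _ = []"

fun is_vertex :: "piece \<Rightarrow> bool" where
  "is_vertex (Merge d e f) = True"
| "is_vertex (Split d e f) = True"
| "is_vertex _ = False"

definition well_oriented :: "piece \<Rightarrow> bool" where
  "well_oriented g \<longleftrightarrow> (is_vertex g \<longrightarrow> count_list (outgoing_legs g) True \<in> {1, 2})"

text \<open>The layer \<open>(p, g)\<close> has \<open>p\<close> vertical strands to the left of the piece \<open>g\<close>.\<close>

type_synonym layer = "nat \<times> piece"
type_synonym movie = "dir list \<times> layer list"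

fun fits :: "layer \<Rightarrow> dir list \<Rightarrow> bool" where
  "fits (p, g) u \<longleftrightarrow> well_oriented g \<and> p + length (source g) \<le> length u \<and>
     take (length (source g)) (drop p u) = source g"

fun after :: "layer \<Rightarrow> dir list \<Rightarrow> dir list" where
  "after (p, g) u = take p u @ target g @ drop (p + length (source g)) u"

fun composable :: "dir list \<Rightarrow> layer list \<Rightarrow> bool" where
  "composable u [] \<longleftrightarrow> True"
| "composable u (l # ls) \<longleftrightarrow> fits l u \<and> composable (after l u) ls"

definition diagram :: "movie \<Rightarrow> bool" where
  "diagram D \<longleftrightarrow> composable (fst D) (snd D)"

text \<open>The strands crossing the horizontal line just above the first \<open>k\<close> layers.\<close>

definition strands :: "movie \<Rightarrow> nat \<Rightarrow> dir list" where
  "strands D k = fold after (take k (snd D)) (fst D)"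

text \<open>
  A point \<open>(k, i)\<close> is the intersection of the \<open>k\<close>-th horizontal line with its \<open>i\<close>-th
  strand. \<open>joined D x y\<close> holds when the diagram has a strand running between \<open>x\<close> and
  \<open>y\<close> within a single layer without meeting a vertex or passing under another strand.
\<close>

definition points :: "movie \<Rightarrow> (nat \<times> nat) set" where
  "points D = {(k, i). k \<le> length (snd D) \<and> i < length (strands D k)}"

inductive joined :: "movie \<Rightarrow> nat \<times> nat \<Rightarrow> nat \<times> nat \<Rightarrow> bool" for D :: movie where
  left: "k < length (snd D) \<Longrightarrow> snd D ! k = (p, g) \<Longrightarrow> i < p \<Longrightarrow> joined D (k, i) (Suc k, i)"
| right: "k < length (snd D) \<Longrightarrow> snd D ! k = (p, g) \<Longrightarrow> p \<le> i \<Longrightarrow>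
    i + length (source g) < length (strands D k) \<Longrightarrow>
    joined D (k, i + length (source g)) (Suc k, i + length (target g))"
| cup: "k < length (snd D) \<Longrightarrow> snd D ! k = (p, Cup d) \<Longrightarrow> joined D (Suc k, p) (Suc k, Suc p)"
| cap: "k < length (snd D) \<Longrightarrow> snd D ! k = (p, Cap d) \<Longrightarrow> joined D (k, p) (k, Suc p)"
| over_right: "k < length (snd D) \<Longrightarrow> snd D ! k = (p, Cross True d e) \<Longrightarrow>
    joined D (k, p) (Suc k, Suc p)"
| over_left: "k < length (snd D) \<Longrightarrow> snd D ! k = (p, Cross False d e) \<Longrightarrow>
    joined D (k, Suc p) (Suc k, p)"

definition arc_of :: "movie \<Rightarrow> nat \<times> nat \<Rightarrow> (nat \<times> nat) set" where
  "arc_of D x = {y. equivclp (joined D) x y}"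

definition arcs :: "movie \<Rightarrow> (nat \<times> nat) set set" where
  "arcs D = arc_of D ` points D"

text \<open>
  Coloring rules: \<open>crossing_rule\<close> constrains the colors of the over-arc, of the under-arc to its
  right and of the under-arc to its left; \<open>zip_rule\<close> those of the left incoming, right incoming
  and outgoing arc; \<open>unzip_rule\<close> those of the incoming, left outgoing and right outgoing arc.
\<close>

record 'q coloring_rules =
  crossing_rule :: "'q \<Rightarrow> 'q \<Rightarrow> 'q \<Rightarrow> bool"
  zip_rule :: "'q \<Rightarrow> 'q \<Rightarrow> 'q \<Rightarrow> bool"
  unzip_rule :: "'q \<Rightarrow> 'q \<Rightarrow> 'q \<Rightarrow> bool"

text \<open>The last four arguments are the colors at the ends of the crossing, bottom ones first, from left to
  right.\<close>

fun obeys_crossing ::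
  "'q coloring_rules \<Rightarrow> bool \<Rightarrow> dir \<Rightarrow> dir \<Rightarrow> 'q \<Rightarrow> 'q \<Rightarrow> 'q \<Rightarrow> 'q \<Rightarrow> bool" where
  "obeys_crossing R True Up e sw se nw ne = crossing_rule R sw se nw"
| "obeys_crossing R True Down e sw se nw ne = crossing_rule R sw nw se"
| "obeys_crossing R False d Up sw se nw ne = crossing_rule R se ne sw"
| "obeys_crossing R False d Down sw se nw ne = crossing_rule R se sw ne"

text \<open>The legs of a vertex (outgoing or not, and color) are given in counterclockwise order.\<close>

definition obeys_vertex :: "'q coloring_rules \<Rightarrow> (bool \<times> 'q) list \<Rightarrow> bool" where
  "obeys_vertex R l \<longleftrightarrow>
     (\<exists>n<3. \<exists>a b c. rotate n l = [(True, c), (False, a), (False, b)] \<and> zip_rule R a b c) \<or>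
     (\<exists>n<3. \<exists>a b c. rotate n l = [(False, c), (True, b), (True, a)] \<and> unzip_rule R c a b)"

text \<open>
  \<open>lo\<close> and \<open>up\<close> are the colors along the lines below and above the piece, counted from its
  left end.
\<close>

fun obeys :: "'q coloring_rules \<Rightarrow> piece \<Rightarrow> (nat \<Rightarrow> 'q) \<Rightarrow> (nat \<Rightarrow> 'q) \<Rightarrow> bool" where
  "obeys R (Cross ov d e) lo up = obeys_crossing R ov d e (lo 0) (lo 1) (up 0) (up 1)"
| "obeys R (Merge d e f) lo up =
     obeys_vertex R (zip (outgoing_legs (Merge d e f)) [lo 0, lo 1, up 0])"
| "obeys R (Split d e f) lo up =
     obeys_vertex R (zip (outgoing_legs (Split d e f)) [lo 0, up 1, up 0])"
| "obeys R (Cup d) lo up = True"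
| "obeys R (Cap d) lo up = True"

definition colorings ::
  "'q set \<Rightarrow> 'q coloring_rules \<Rightarrow> movie \<Rightarrow> ((nat \<times> nat) set \<Rightarrow> 'q) set" where
  "colorings Q R D = {C \<in> arcs D \<rightarrow>\<^sub>E Q. \<forall>k < length (snd D). \<forall>p g. snd D ! k = (p, g) \<longrightarrow>
     obeys R g (\<lambda>j. C (arc_of D (k, p + j))) (\<lambda>j. C (arc_of D (Suc k, p + j)))}"

text \<open>
  The two sides of an R-move, both as lists of layers with the same bottom and top ends. Turning the
  disc where the move takes place by a planar isotopy brings it into one of the positions below.
  Orientations are arbitrary, subject to well-orientedness, which is imposed on the diagrams in
  \<open>r_move\<close>.

  \<open>I\<close>: the kink lies to the right or to the left of the strand. \<open>III\<close>: \<open>oij\<close> says that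
  strand \<open>i\<close> passes over strand \<open>j\<close>; the two excluded cases are those where no strand is on
  top. \<open>IV_VI\<close>: the vertex points down or up and the strand \<open>s\<close> rises to the right
  (\<open>_a\<close>) or to the left (\<open>_b\<close>); it crosses the two legs lying on one side of the vertex
  or the single leg on the other, passing under all of them (move IV) or over all of them
  (move VI) according to \<open>ov\<close>.
\<close>

inductive r_sides :: "layer list \<Rightarrow> layer list \<Rightarrow> bool" where
  I_right: "r_sides [] [(1, Cup d), (0, Cross ov d d), (1, Cap d)]"
| I_left: "r_sides [] [(0, Cup (opp d)), (1, Cross ov d d), (0, Cap (opp d))]"
| II: "r_sides [] [(0, Cross ov d e), (0, Cross (\<not> ov) e d)]"
| III: "\<not> (o12 \<and> o23 \<and> \<not> o13) \<Longrightarrow> \<not> (\<not> o12 \<and> \<not> o23 \<and> o13) \<Longrightarrow>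
    r_sides [(0, Cross o12 d1 d2), (1, Cross o13 d1 d3), (0, Cross o23 d2 d3)]
            [(1, Cross o23 d2 d3), (0, Cross o13 d1 d3), (1, Cross o12 d1 d2)]"
| IV_VI_Merge_a:
    "r_sides [(0, Cross ov s d), (1, Cross ov s e), (0, Merge d e f)]
             [(1, Merge d e f), (0, Cross ov s f)]"
| IV_VI_Merge_b:
    "r_sides [(1, Cross ov e s), (0, Cross ov d s), (1, Merge d e f)]
             [(0, Merge d e f), (0, Cross ov f s)]"
| IV_VI_Split_a:
    "r_sides [(1, Split d e f), (0, Cross ov s e), (1, Cross ov s f)]
             [(0, Cross ov s d), (0, Split d e f)]"
| IV_VI_Split_b:
    "r_sides [(0, Split d e f), (1, Cross ov f s), (0, Cross ov e s)]
             [(0, Cross ov d s), (1, Split d e f)]"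
| V_Merge: "r_sides [(0, Merge d e f)] [(0, Cross ov d e), (0, Merge e d f)]"
| V_Split: "r_sides [(0, Split d e f)] [(0, Split d f e), (0, Cross ov f e)]"

definition shift :: "nat \<Rightarrow> layer list \<Rightarrow> layer list" where
  "shift p = map (\<lambda>(q, g). (p + q, g))"

text \<open>
  \<open>r_move D D' m n n'\<close>: replacing the layers \<open>m, \<dots>, m + n - 1\<close> of \<open>D\<close>, whose pieces lie in
  the ball of an R-move, by \<open>n'\<close> layers gives \<open>D'\<close>.
\<close>

definition r_move :: "movie \<Rightarrow> movie \<Rightarrow> nat \<Rightarrow> nat \<Rightarrow> nat \<Rightarrow> bool" where
  "r_move D D' m n n' \<longleftrightarrow> diagram D \<and> diagram D' \<and>
     (\<exists>u A p L L' B. D = (u, A @ shift p L @ B) \<and> D' = (u, A @ shift p L' @ B) \<and>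
        (r_sides L L' \<or> r_sides L' L) \<and> m = length A \<and> n = length L \<and> n' = length L')"

text \<open>
  Strands passing beside the ball run vertically from its bottom line to its top line, so the part
  of the diagram outside the ball is covered by the points on and below its bottom line and those
  on and above its top line.
\<close>

definition coincide_outside ::
  "movie \<Rightarrow> movie \<Rightarrow> nat \<Rightarrow> nat \<Rightarrow> nat \<Rightarrow>
   ((nat \<times> nat) set \<Rightarrow> 'q) \<Rightarrow> ((nat \<times> nat) set \<Rightarrow> 'q) \<Rightarrow> bool" where
  "coincide_outside D D' m n n' C C' \<longleftrightarrow>
     (\<forall>k i. k \<le> m \<and> (k, i) \<in> points D \<longrightarrow> C' (arc_of D' (k, i)) = C (arc_of D (k, i))) \<and>
     (\<forall>k i. (m + n + k, i) \<in> points D \<longrightarrow>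
        C' (arc_of D' (m + n' + k, i)) = C (arc_of D (m + n + k, i)))"

definition topological :: "'q set \<Rightarrow> 'q coloring_rules \<Rightarrow> bool" where
  "topological Q R \<longleftrightarrow>
     (\<forall>D D' m n n'. r_move D D' m n n' \<longrightarrow>
        (\<forall>C \<in> colorings Q R D. \<exists>!C'. C' \<in> colorings Q R D' \<and> coincide_outside D D' m n n' C C'))"

definition squandle_rules :: "('q \<Rightarrow> 'q \<Rightarrow> 'q) \<Rightarrow> ('q \<Rightarrow> 'q) \<Rightarrow> 'q coloring_rules" where
  "squandle_rules tri sq =
     \<lparr>crossing_rule = (\<lambda>b a c. c = tri a b),
      zip_rule = (\<lambda>a b c. a = b \<and> c = sq a),
      unzip_rule = (\<lambda>c a b. a = b \<and> c = sq a)\<rparr>"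

definition squandle :: "'q set \<Rightarrow> ('q \<Rightarrow> 'q \<Rightarrow> 'q) \<Rightarrow> ('q \<Rightarrow> 'q) \<Rightarrow> bool" where
  "squandle Q tri sq \<longleftrightarrow>
     tri \<in> Q \<rightarrow> Q \<rightarrow> Q \<and> sq \<in> Q \<rightarrow> Q \<and>
     (\<exists>itri \<in> Q \<rightarrow> Q \<rightarrow> Q. \<forall>a \<in> Q. \<forall>b \<in> Q. \<forall>c \<in> Q.
        tri (tri a b) c = tri (tri a c) (tri b c) \<and>
        itri (tri a b) b = a \<and> tri (itri a b) b = a \<and>
        tri a a = a \<and>
        tri a (sq b) = tri (tri a b) b \<and>
        tri (sq a) b = sq (tri a b))"

end

theory Submission
  imports Defs
begin

text \<open>
  Cut a diagram by horizontal lines. A coloring becomes a sequence of rows of colors, one for each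
  line, such that consecutive rows fit the piece between them (a film). An R-move
  replaces some consecutive layers, so the rules are topological if and only if, for the two sides
  of every R-move, any film on one side can be replaced by exactly one film on the other with the
  same first and last row. Lemma \<open>topological_if_unique_refill\<close> is one implication, and
  \<open>refill_if_topological\<close> is the existence part of the other. Strands to the left of the move can be
  ignored (\<open>unique_refill_shift\<close>).

  If \<open>Q\<close> is a squandle, passing under a strand of color \<open>b\<close> applies \<open>tri _ b\<close> or its inverse,
  according to the orientation. Both are automorphisms of the operation and commute with squaring.
  Written in terms of this action, the laws have one form for all orientations: move II holds since
  the two directions are inverse to each other, III is distributivity, I is idempotence, VI is
  compatibility with squaring, IV is the law for the action of a square, and V follows from the
  idempotence since \<open>a\<close> and \<open>sq a\<close> act trivially on each other. The colors inside the ball are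
  unique: the loop of a kink must carry the color of its strand, crossings determine colors in both
  directions, and the two legs on one side of a vertex determine the leg on the other.

  Conversely, suitably oriented moves I, II, III, IV and VI, taken as diagrams on their own, give
  the laws one by one (\<open>topological_imp_squandle\<close>).
\<close>

section \<open>Colorings as films\<close>

text \<open>
  The condition that an arc is not interrupted: the two ends of a strand that runs through \<open>g\<close>
  without being cut have the same color. The arguments \<open>lo\<close> and \<open>up\<close> are those of \<open>obeys\<close>.
\<close>

fun passes :: "piece \<Rightarrow> (nat \<Rightarrow> 'q) \<Rightarrow> (nat \<Rightarrow> 'q) \<Rightarrow> bool" where
  "passes (Cup d) lo up \<longleftrightarrow> up 0 = up 1"
| "passes (Cap d) lo up \<longleftrightarrow> lo 0 = lo 1"
| "passes (Cross ov d e) lo up \<longleftrightarrow> (if ov then up 1 = lo 0 else up 0 = lo 1)"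
| "passes (Merge d e f) lo up \<longleftrightarrow> True"
| "passes (Split d e f) lo up \<longleftrightarrow> True"

text \<open>
  All that a coloring has to satisfy within one layer: \<open>w\<close> and \<open>v\<close> list the colors met by the
  horizontal lines below and above it. The colors beside the piece are carried over unchanged.
\<close>

fun step :: "'q set \<Rightarrow> 'q coloring_rules \<Rightarrow> layer \<Rightarrow> 'q list \<Rightarrow> 'q list \<Rightarrow> bool" where
  "step Q R (p, g) w v \<longleftrightarrow> set w \<subseteq> Q \<and> set v \<subseteq> Q \<and>
     p + length (source g) \<le> length w \<and> p + length (target g) \<le> length v \<and>
     take p v = take p w \<and> drop (p + length (target g)) v = drop (p + length (source g)) w \<and>
     passes g (\<lambda>j. w ! (p + j)) (\<lambda>j. v ! (p + j)) \<and>
     obeys R g (\<lambda>j. w ! (p + j)) (\<lambda>j. v ! (p + j))"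

declare step.simps [simp del]

text \<open>
  A coloring seen as a movie of its own, with one row of colors for each horizontal line. Arcs have
  disappeared from this description, so that it can be cut and pasted along horizontal lines.
\<close>

definition film :: "'q set \<Rightarrow> 'q coloring_rules \<Rightarrow> layer list \<Rightarrow> 'q list list \<Rightarrow> bool" where
  "film Q R ls W \<longleftrightarrow> length W = Suc (length ls) \<and> set (hd W) \<subseteq> Q \<and>
     (\<forall>k < length ls. step Q R (ls ! k) (W ! k) (W ! Suc k))"

definition films :: "'q set \<Rightarrow> 'q coloring_rules \<Rightarrow> movie \<Rightarrow> 'q list list set" where
  "films Q R D = {W. film Q R (snd D) W \<and> length (hd W) = length (fst D)}"

definition rows :: "movie \<Rightarrow> ((nat \<times> nat) set \<Rightarrow> 'q) \<Rightarrow> 'q list list" where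
  "rows D C = map (\<lambda>k. map (\<lambda>i. C (arc_of D (k, i))) [0..<length (strands D k)])
     [0..<Suc (length (snd D))]"

lemma length_rows [simp]: "length (rows D C) = Suc (length (snd D))"
  by (simp add: rows_def)

lemma rows_nth:
  "k \<le> length (snd D) \<Longrightarrow>
     rows D C ! k = map (\<lambda>i. C (arc_of D (k, i))) [0..<length (strands D k)]"
  unfolding rows_def by (subst nth_map) (auto simp del: upt_Suc)

lemma strands_0: "strands D 0 = fst D"
  by (simp add: strands_def)

lemma strands_Suc: "k < length (snd D) \<Longrightarrow> strands D (Suc k) = after (snd D ! k) (strands D k)"
  by (simp add: strands_def take_Suc_conv_app_nth)

lemma composable_append:
  "composable u (A @ B) \<longleftrightarrow> composable u A \<and> composable (fold after A u) B"
  by (induction A arbitrary: u) auto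

lemma fits_strands:
  assumes "diagram D" "k < length (snd D)"
  shows "fits (snd D ! k) (strands D k)"
proof -
  have "snd D = take k (snd D) @ snd D ! k # drop (Suc k) (snd D)"
    using assms(2) by (rule id_take_nth_drop)
  then show ?thesis
    using assms(1) composable_append[of "fst D" "take k (snd D)"]
    unfolding diagram_def strands_def by (metis composable.simps(2))
qed

lemma length_after: "fits (p, g) u \<Longrightarrow> length (after (p, g) u) + length (source g) = length u + length (target g)"
  by auto

lemma step_length:
  assumes "step Q R l w v" "fits l u" "length w = length u"
  shows "length v = length (after l u)"
proof -
  obtain p g where l: "l = (p, g)" by (cases l)
  have "length v - (p + length (target g)) = length w - (p + length (source g))"
    using assms(1) unfolding l step.simps by (metis length_drop)
  then show ?thesis
    using assms length_after[of p g u] unfolding l step.simps by linarith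
qed

lemma film_row_length:
  assumes D: "diagram D" and W: "W \<in> films Q R D" and k: "k \<le> length (snd D)"
  shows "length (W ! k) = length (strands D k)"
  using k
proof (induction k)
  case 0
  have "W \<noteq> []" using W by (auto simp: films_def film_def)
  then show ?case using W by (simp add: films_def strands_0 hd_conv_nth)
next
  case (Suc k)
  then have "step Q R (snd D ! k) (W ! k) (W ! Suc k)" "fits (snd D ! k) (strands D k)"
    using W fits_strands[OF D] by (auto simp: films_def film_def)
  then show ?case using Suc step_length strands_Suc[of k D] by fastforce
qed

lemma film_colors:
  assumes W: "film Q R ls W" and k: "k \<le> length ls"
  shows "set (W ! k) \<subseteq> Q"
proof (cases k)
  case 0
  moreover have "W \<noteq> []" using W by (auto simp: film_def)
  ultimately show ?thesis using W by (simp add: film_def hd_conv_nth)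
next
  case (Suc j)
  then have "step Q R (ls ! j) (W ! j) (W ! Suc j)" using W k by (auto simp: film_def)
  then show ?thesis using Suc by (cases "ls ! j") (simp add: step.simps)
qed

lemma passes_cong:
  "\<lbrakk>\<And>j. j < length (source g) \<Longrightarrow> lo j = lo' j; \<And>j. j < length (target g) \<Longrightarrow> up j = up' j\<rbrakk>
     \<Longrightarrow> passes g lo up = passes g lo' up'"
  by (cases g) auto

lemma obeys_cong:
  assumes lo: "\<And>j. j < length (source g) \<Longrightarrow> lo j = lo' j"
    and up: "\<And>j. j < length (target g) \<Longrightarrow> up j = up' j"
  shows "obeys R g lo up = obeys R g lo' up'"
proof (cases g)
  case (Cross ov d e)
  then have "lo 0 = lo' 0" "lo 1 = lo' 1" "up 0 = up' 0" "up 1 = up' 1"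
    using lo up by auto
  then show ?thesis by (simp only: Cross obeys.simps)
next
  case (Merge d e f)
  then have "lo 0 = lo' 0" "lo 1 = lo' 1" "up 0 = up' 0" using lo up by auto
  then show ?thesis by (simp only: Merge obeys.simps)
next
  case (Split d e f)
  then have "lo 0 = lo' 0" "up 1 = up' 1" "up 0 = up' 0" using lo up by auto
  then show ?thesis by (simp only: Split obeys.simps)
qed simp_all

lemma arc_of_joined: "joined D x y \<Longrightarrow> arc_of D x = arc_of D y"
  unfolding arc_of_def
  by (blast intro: equivclp_sym equivclp_trans r_into_equivclp)

text \<open>
  Constancy along arcs, the equivalence classes of \<open>joined\<close>, needs to be checked on single strands
  only.
\<close>

lemma equivclp_invariant:
  assumes "equivclp r x y" "\<And>x y. r x y \<Longrightarrow> f x = f y"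
  shows "f x = f y"
  using assms(1)
proof (induction rule: equivclp_induct)
  case base show ?case by simp
next
  case (step y z)
  then show ?case using assms(2)[of y z] assms(2)[of z y] by argo
qed

text \<open>
  A coloring gives a film: each clause of \<open>step\<close> comes from a rule of \<open>joined\<close> or from the coloring
  rule of the piece.
\<close>

lemma rows_in_films:
  assumes D: "diagram D" and C: "C \<in> colorings Q R D"
  shows "rows D C \<in> films Q R D"
proof -
  have CQ: "C (arc_of D x) \<in> Q" if "x \<in> points D" for x
    using C that by (auto simp: colorings_def arcs_def)
  have rowQ: "set (rows D C ! k) \<subseteq> Q" if "k \<le> length (snd D)" for k
    using that CQ by (auto simp: rows_nth points_def)
  have "step Q R (snd D ! k) (rows D C ! k) (rows D C ! Suc k)" if k: "k < length (snd D)" for k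
  proof -
    obtain p g where pg: "snd D ! k = (p, g)" by fastforce
    define u v where "u = strands D k" and "v = strands D (Suc k)"
    have f: "fits (p, g) u" using fits_strands[OF D k] by (simp add: pg u_def)
    have v: "v = after (p, g) u" using strands_Suc[OF k] by (simp add: pg u_def v_def)
    let ?w = "rows D C ! k" and ?v = "rows D C ! Suc k"
    have w: "?w = map (\<lambda>i. C (arc_of D (k, i))) [0..<length u]"
      and v': "?v = map (\<lambda>i. C (arc_of D (Suc k, i))) [0..<length v]"
      using k by (simp_all add: rows_nth u_def v_def)
    have lens: "length v + length (source g) = length u + length (target g)"
      using length_after[OF f] v by simp
    have le: "p + length (source g) \<le> length u" using f by simp
    have tk: "take p ?v = take p ?w"
    proof (rule nth_equalityI)
      have "p \<le> length u" "p \<le> length v" using le lens by linarith+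
      then show "length (take p ?v) = length (take p ?w)" by (simp add: w v')
      fix i assume "i < length (take p ?v)"
      then have "i < p" "i < length u" "i < length v" using le lens by (auto simp: v')
      then show "take p ?v ! i = take p ?w ! i"
        using arc_of_joined[OF joined.left[OF k pg \<open>i < p\<close>]] by (simp add: w v')
    qed
    have dr: "drop (p + length (target g)) ?v = drop (p + length (source g)) ?w"
    proof (rule nth_equalityI)
      fix i assume "i < length (drop (p + length (target g)) ?v)"
      then have i: "p + length (target g) + i < length v" by (simp add: v')
      have i': "p + length (source g) + i < length u" using i lens by linarith
      have eq: "p + i + length (source g) = p + length (source g) + i"
        "p + i + length (target g) = p + length (target g) + i" by linarith+
      have "joined D (k, p + length (source g) + i) (Suc k, p + length (target g) + i)"
        using joined.right[OF k pg, of "p + i"] i' by (simp only: eq u_def le_add1)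
      from arc_of_joined[OF this]
      show "drop (p + length (target g)) ?v ! i = drop (p + length (source g)) ?w ! i"
        using i i' by (simp add: w v')
    next
      show "length (drop (p + length (target g)) ?v) = length (drop (p + length (source g)) ?w)"
        using lens le unfolding w v' length_drop length_map length_upt by linarith
    qed
    have wn: "?w ! (p + j) = C (arc_of D (k, p + j))" if "j < length (source g)" for j
      using that le by (simp add: w)
    have vn: "?v ! (p + j) = C (arc_of D (Suc k, p + j))" if "j < length (target g)" for j
      using that le lens by (simp add: v')
    have "passes g (\<lambda>j. C (arc_of D (k, p + j))) (\<lambda>j. C (arc_of D (Suc k, p + j)))"
    proof (cases g)
      case (Cup d)
      then have "snd D ! k = (p, Cup d)" using pg by simp
      from arc_of_joined[OF joined.cup[OF k this]] Cup show ?thesis by simp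
    next
      case (Cap d)
      then have "snd D ! k = (p, Cap d)" using pg by simp
      from arc_of_joined[OF joined.cap[OF k this]] Cap show ?thesis by simp
    next
      case (Cross ov d e)
      then have "snd D ! k = (p, Cross ov d e)" using pg by simp
      with arc_of_joined[OF joined.over_left[OF k, of p d e]]
        arc_of_joined[OF joined.over_right[OF k, of p d e]] Cross
      show ?thesis by (cases ov) simp_all
    qed simp_all
    then have "passes g (\<lambda>j. ?w ! (p + j)) (\<lambda>j. ?v ! (p + j))"
      by (rule passes_cong[THEN iffD1, rotated 2]) (erule wn[symmetric] vn[symmetric])+
    moreover have "obeys R g (\<lambda>j. C (arc_of D (k, p + j))) (\<lambda>j. C (arc_of D (Suc k, p + j)))"
      using C k pg by (auto simp: colorings_def)
    then have "obeys R g (\<lambda>j. ?w ! (p + j)) (\<lambda>j. ?v ! (p + j))"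
      by (rule obeys_cong[THEN iffD1, rotated 2]) (erule wn[symmetric] vn[symmetric])+
    moreover have "set ?w \<subseteq> Q" "set ?v \<subseteq> Q"
      by (rule rowQ[OF less_imp_le[OF k]], rule rowQ[OF Suc_leI[OF k]])
    moreover have "p + length (source g) \<le> length ?w" "p + length (target g) \<le> length ?v"
      using le lens unfolding w v' length_map length_upt by linarith+
    ultimately show ?thesis
      unfolding pg step.simps by (intro conjI tk dr)
  qed
  moreover have "hd (rows D C) = rows D C ! 0"
    by (rule hd_conv_nth) (simp add: rows_def)
  ultimately show ?thesis using rowQ[of 0] by (simp add: films_def film_def rows_nth strands_0)
qed

text \<open>
  Conversely, the color at a point of a film is constant along \<open>joined\<close>, because every
  rule of \<open>joined\<close> is covered by a clause of \<open>step\<close>; hence it descends to arcs.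
\<close>

lemma film_is_rows:
  assumes D: "diagram D" and W: "W \<in> films Q R D"
  shows "\<exists>C \<in> colorings Q R D. rows D C = W"
proof -
  define f where "f = (\<lambda>(k, i). W ! k ! i)"
  note len = film_row_length[OF D W]
  have st: "step Q R (snd D ! k) (W ! k) (W ! Suc k)" if "k < length (snd D)" for k
    using W that by (auto simp: films_def film_def)
  have fj: "f x = f y" if "joined D x y" for x y
    using that
  proof cases
    case (left k p g i)
    then have "take p (W ! Suc k) ! i = take p (W ! k) ! i" using st[of k] by (simp add: step.simps)
    then show ?thesis using left by (simp add: f_def)
  next
    case (right k p g i)
    have "drop (p + length (target g)) (W ! Suc k) ! (i - p) =
        drop (p + length (source g)) (W ! k) ! (i - p)"
      using st[of k] right by (simp add: step.simps)
    moreover have "p + length (target g) \<le> length (W ! Suc k)" "p + length (source g) \<le> length (W ! k)"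
      using st[of k] right by (simp_all add: step.simps)
    ultimately show ?thesis
      using right by (simp add: f_def ac_simps)
  next
    case (cup k p d) then show ?thesis using st[of k] by (simp add: step.simps f_def)
  next
    case (cap k p d) then show ?thesis using st[of k] by (simp add: step.simps f_def)
  next
    case (over_right k p d e) then show ?thesis using st[of k] by (simp add: step.simps f_def)
  next
    case (over_left k p d e) then show ?thesis using st[of k] by (simp add: step.simps f_def)
  qed
  define C where "C = restrict (\<lambda>S. f (SOME x. x \<in> S)) (arcs D)"
  have C: "C (arc_of D x) = f x" if "x \<in> points D" for x
  proof -
    have "x \<in> arc_of D x" by (simp add: arc_of_def)
    then have "(SOME y. y \<in> arc_of D x) \<in> arc_of D x" by (rule someI)
    then have "equivclp (joined D) x (SOME y. y \<in> arc_of D x)" by (simp add: arc_of_def)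
    from equivclp_invariant[of _ _ _ f, OF this fj] show ?thesis
      using that by (simp add: C_def arcs_def)
  qed
  have Cf: "C (arc_of D (k, i)) = W ! k ! i"
    if "k \<le> length (snd D)" "i < length (strands D k)" for k i
    using C[of "(k, i)"] that by (simp add: points_def f_def)
  have "f x \<in> Q" if "x \<in> points D" for x
    using that film_colors[of Q R "snd D" W] W len
    by (auto simp: points_def f_def films_def) (metis nth_mem subsetD)
  then have "C \<in> arcs D \<rightarrow>\<^sub>E Q"
    using C by (auto simp: arcs_def C_def)
  moreover have "obeys R g (\<lambda>j. C (arc_of D (k, p + j))) (\<lambda>j. C (arc_of D (Suc k, p + j)))"
    if k: "k < length (snd D)" and pg: "snd D ! k = (p, g)" for k p g
  proof -
    have s: "step Q R (p, g) (W ! k) (W ! Suc k)" using st[OF k] pg by simp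
    then have "obeys R g (\<lambda>j. W ! k ! (p + j)) (\<lambda>j. W ! Suc k ! (p + j))"
      "p + length (source g) \<le> length (W ! k)" "p + length (target g) \<le> length (W ! Suc k)"
      by (simp_all add: step.simps)
    then show ?thesis
      using Cf k len[of k] len[of "Suc k"]
        obeys_cong[of g "\<lambda>j. C (arc_of D (k, p + j))" "\<lambda>j. W ! k ! (p + j)"
          "\<lambda>j. C (arc_of D (Suc k, p + j))" "\<lambda>j. W ! Suc k ! (p + j)" R] by simp
  qed
  ultimately have "C \<in> colorings Q R D" by (simp add: colorings_def)
  moreover have "rows D C = W"
  proof (rule nth_equalityI)
    show "length (rows D C) = length W" using W by (simp add: films_def film_def)
    fix k assume "k < length (rows D C)"
    then have k: "k \<le> length (snd D)" by simp
    then show "rows D C ! k = W ! k"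
      by (intro nth_equalityI) (auto simp: rows_nth len Cf)
  qed
  ultimately show ?thesis by blast
qed

text \<open>
  Every arc contains a point, so the rows determine the coloring.
\<close>

lemma rows_inj:
  assumes "C \<in> colorings Q R D" "C' \<in> colorings Q R D" "rows D C = rows D C'"
  shows "C = C'"
proof (rule PiE_ext[of _ "arcs D" "\<lambda>_. Q"])
  show "C \<in> arcs D \<rightarrow>\<^sub>E Q" "C' \<in> arcs D \<rightarrow>\<^sub>E Q" using assms by (simp_all add: colorings_def)
  fix S assume "S \<in> arcs D"
  then obtain k i where S: "S = arc_of D (k, i)" and ki: "k \<le> length (snd D)" "i < length (strands D k)"
    by (auto simp: arcs_def points_def)
  have "rows D C ! k ! i = rows D C' ! k ! i" using assms(3) by simp
  then show "C S = C' S" using ki by (simp add: S rows_nth)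
qed

section \<open>Locality of R-moves\<close>

lemma strands_append:
  "strands (u, A @ B) (length A + k) = fold after (take k B) (fold after A u)"
  by (simp add: strands_def)

lemma strands_below: "k \<le> length A \<Longrightarrow> strands (u, A @ B) k = fold after (take k A) u"
  by (simp add: strands_def)

lemma shift_Nil [simp]: "shift p [] = []"
  and shift_Cons [simp]: "shift p ((q, g) # L) = (p + q, g) # shift p L"
  and length_shift [simp]: "length (shift p L) = length L"
  by (simp_all add: shift_def)

lemma fits_append: "fits (length x + q, g) (x @ u) \<longleftrightarrow> fits (q, g) u"
  by auto

lemma after_append: "after (length x + q, g) (x @ u) = x @ after (q, g) u"
  by (simp add: add.assoc)

lemma composable_shift: "composable (x @ u) (shift (length x) L) \<longleftrightarrow> composable u L"
  by (induction L arbitrary: u) (auto simp: fits_append after_append simp del: fits.simps after.simps)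

lemma fold_after_shift: "fold after (shift (length x) L) (x @ u) = x @ fold after L u"
  by (induction L arbitrary: u) (auto simp: after_append simp del: after.simps)

lemma fits_0: "fits (0, g) u \<longleftrightarrow> well_oriented g \<and> (\<exists>z. u = source g @ z)"
  by (auto simp: append_eq_conv_conj) (metis append_take_drop_id)

lemma fits_Suc: "fits (Suc p, g) u \<longleftrightarrow> (\<exists>a z. u = a # z \<and> fits (p, g) z)"
  by (cases u) auto

text \<open>
  The two sides of an R-move have the same ends at the top as well, so that the layers above the
  ball carry the same strands before and after the move.
\<close>

lemma r_sides_same_top:
  assumes "r_sides L L'" "composable u L" "composable u L'"
  shows "fold after L u = fold after L' u"
  using assms
  by cases (auto simp: fits_0 fits_Suc simp del: fits.simps)

lemma r_sides_nonempty: "r_sides L L' \<Longrightarrow> L' \<noteq> []"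
  by (auto elim: r_sides.cases)

text \<open>
  The strands to the left of the ball exist as soon as one side of the move is not empty.
\<close>

lemma composable_shift_split:
  assumes "composable u (shift p L)" "L \<noteq> []"
  obtains x u0 where "u = x @ u0" "length x = p"
proof
  show "u = take p u @ drop p u" by simp
  show "length (take p u) = p" using assms by (cases L) auto
qed

lemma r_sides_ends:
  assumes "r_sides L L'" "composable u (shift p L)" "composable u (shift p L')"
  shows "fold after (shift p L) u = fold after (shift p L') u"
proof -
  obtain x u0 where "u = x @ u0" "p = length x"
    using composable_shift_split[OF assms(3) r_sides_nonempty[OF assms(1)]] by metis
  then show ?thesis
    using assms r_sides_same_top by (simp add: composable_shift fold_after_shift)
qed

text \<open>
  The counterpart of \<open>coincide_outside\<close> for films. The bottom and the top line of the ball belong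
  to the outside.
\<close>

definition agree_outside ::
  "nat \<Rightarrow> nat \<Rightarrow> nat \<Rightarrow> 'q list list \<Rightarrow> 'q list list \<Rightarrow> bool" where
  "agree_outside m n n' W W' \<longleftrightarrow>
     take (Suc m) W' = take (Suc m) W \<and> drop (m + n') W' = drop (m + n) W"

lemma agree_outside_nth:
  assumes "length W = Suc (m + n + b)" "length W' = Suc (m + n' + b)"
  shows "agree_outside m n n' W W' \<longleftrightarrow>
    (\<forall>k\<le>m. W' ! k = W ! k) \<and> (\<forall>k\<le>b. W' ! (m + n' + k) = W ! (m + n + k))"
proof -
  have "take (Suc m) W' = take (Suc m) W \<longleftrightarrow> (\<forall>k\<le>m. W' ! k = W ! k)"
    using assms by (auto simp: list_eq_iff_nth_eq less_Suc_eq_le)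
  moreover have "drop (m + n') W' = drop (m + n) W \<longleftrightarrow>
      (\<forall>k\<le>b. W' ! (m + n' + k) = W ! (m + n + k))"
    using assms by (simp add: list_eq_iff_nth_eq less_Suc_eq_le)
  ultimately show ?thesis by (simp add: agree_outside_def)
qed

lemma coincide_outside_rows:
  assumes ends: "fold after S (fold after A u) = fold after S' (fold after A u)"
    and D: "D = (u, A @ S @ B)" and D': "D' = (u, A @ S' @ B)"
  shows "coincide_outside D D' (length A) (length S) (length S') C C' \<longleftrightarrow>
     agree_outside (length A) (length S) (length S') (rows D C) (rows D' C')"
proof -
  let ?m = "length A" and ?n = "length S" and ?n' = "length S'" and ?b = "length B"
  have below: "strands D' k = strands D k" if "k \<le> ?m" for k
    using that by (simp add: D D' strands_below)
  have above: "strands D' (?m + ?n' + k) = strands D (?m + ?n + k)" for k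
    using strands_append[of u "A @ S" B k] strands_append[of u "A @ S'" B k] ends
    by (simp add: D D' add.assoc)
  have lens: "length (snd D) = ?m + ?n + ?b" "length (snd D') = ?m + ?n' + ?b"
    by (simp_all add: D D')
  have row_eq: "rows D' C' ! k' = rows D C ! k \<longleftrightarrow>
      (\<forall>i < length (strands D k). C' (arc_of D' (k', i)) = C (arc_of D (k, i)))"
    if "strands D' k' = strands D k" "k \<le> length (snd D)" "k' \<le> length (snd D')" for k k'
    using that by (auto simp: rows_nth)
  have "(\<forall>k i. k \<le> ?m \<and> (k, i) \<in> points D \<longrightarrow> C' (arc_of D' (k, i)) = C (arc_of D (k, i)))
      \<longleftrightarrow> (\<forall>k\<le>?m. rows D' C' ! k = rows D C ! k)"
    using row_eq[OF below] lens by (auto simp: points_def)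
  moreover have "(\<forall>k i. (?m + ?n + k, i) \<in> points D \<longrightarrow>
        C' (arc_of D' (?m + ?n' + k, i)) = C (arc_of D (?m + ?n + k, i)))
      \<longleftrightarrow> (\<forall>k\<le>?b. rows D' C' ! (?m + ?n' + k) = rows D C ! (?m + ?n + k))"
    using row_eq[OF above] lens by (auto simp: points_def)
  ultimately show ?thesis
    unfolding coincide_outside_def
    by (subst agree_outside_nth[where b = ?b]) (simp_all add: lens)
qed

text \<open>
  The topological property for a diagram that consists of the ball only: the colors outside are
  those of the bottom and of the top row.
\<close>

definition unique_refill :: "'q set \<Rightarrow> 'q coloring_rules \<Rightarrow> dir list \<Rightarrow> layer list \<Rightarrow> layer list \<Rightarrow> bool" where
  "unique_refill Q R u S S' \<longleftrightarrow>
     (\<forall>V \<in> films Q R (u, S). \<exists>!V'. V' \<in> films Q R (u, S') \<and> hd V' = hd V \<and> last V' = last V)"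

lemma film_append:
  "film Q R (A @ B) W \<longleftrightarrow> film Q R A (take (Suc (length A)) W) \<and> film Q R B (drop (length A) W)"
  (is "?L \<longleftrightarrow> ?A \<and> ?B")
proof
  assume L: ?L
  then have len: "length W = Suc (length A + length B)" by (simp add: film_def)
  have "hd (drop (length A) W) = W ! length A" using len by (simp add: hd_drop_conv_nth)
  then have "set (hd (drop (length A) W)) \<subseteq> Q" using film_colors[OF L] by simp
  moreover have "step Q R (B ! k) (W ! (length A + k)) (W ! Suc (length A + k))"
    if "k < length B" for k
    using L that nth_append_length_plus[of A B k] by (auto simp: film_def dest!: spec[of _ "length A + k"])
  ultimately have ?B using len by (simp add: film_def)
  moreover have "step Q R (A ! k) (W ! k) (W ! Suc k)" if "k < length A" for k
    using L that by (auto simp: film_def nth_append dest!: spec[of _ k])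
  then have ?A using L len by (simp add: film_def hd_take)
  ultimately show "?A \<and> ?B" by simp
next
  assume AB: "?A \<and> ?B"
  then have len: "length W = Suc (length A + length B)"
    by (auto simp: film_def)
  have "step Q R ((A @ B) ! k) (W ! k) (W ! Suc k)" if k: "k < length A + length B" for k
  proof (cases "k < length A")
    case True
    then have "step Q R (A ! k) (take (Suc (length A)) W ! k) (take (Suc (length A)) W ! Suc k)"
      using AB by (simp add: film_def)
    then show ?thesis using True by (simp add: nth_append)
  next
    case False
    then have "k - length A < length B" using k by simp
    then have "step Q R (B ! (k - length A)) (drop (length A) W ! (k - length A))
        (drop (length A) W ! Suc (k - length A))"
      using AB by (simp add: film_def)
    then show ?thesis using False len by (simp add: nth_append Suc_diff_le)
  qed
  moreover have "W \<noteq> []" using len by auto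
  then have "set (hd W) \<subseteq> Q" using AB by (simp add: film_def hd_take)
  ultimately show ?L using len by (simp add: film_def)
qed

text \<open>
  Replacing the rows of \<open>W\<close> in the ball by a film \<open>V'\<close> with the same first and last row changes
  nothing outside the ball.
\<close>

lemma refill_film:
  assumes len: "length W = Suc (length A + length S + length B)"
    and V': "length V' = Suc (length S')" "hd V' = W ! length A" "last V' = W ! (length A + length S)"
  defines "W' \<equiv> take (length A) W @ V' @ drop (Suc (length A + length S)) W"
  shows "take (Suc (length A)) W' = take (Suc (length A)) W" (is ?t1)
    and "take (Suc (length S')) (drop (length A) W') = V'" (is ?t2)
    and "drop (length A + length S') W' = drop (length A + length S) W" (is ?t3)
proof -
  obtain v V1 where v: "V' = v # V1" using V' by (cases V') auto
  obtain y V2 where y: "V' = V2 @ [y]" using V' by (cases V' rule: rev_cases) auto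
  show ?t1 using len V'(2) by (simp add: W'_def v take_Suc_conv_app_nth)
  show ?t2 using len V'(1) by (simp add: W'_def)
  have "drop (length A + length S) W = W ! (length A + length S) # drop (Suc (length A + length S)) W"
    using len by (intro Cons_nth_drop_Suc[symmetric]) simp
  then show ?t3 using len V'(1,3) by (simp add: W'_def y)
qed

text \<open>
  Invariance is local. The film of a coloring is cut into the parts below, inside and above the
  ball; only the middle part has to be replaced, and it can be replaced in one way.
\<close>

lemma topological_if_unique_refill:
  assumes "\<And>u p L L'. r_sides L L' \<or> r_sides L' L \<Longrightarrow> composable u (shift p L) \<Longrightarrow>
     composable u (shift p L') \<Longrightarrow> unique_refill Q R u (shift p L) (shift p L')"
  shows "topological Q R"
  unfolding topological_def
proof (intro allI impI ballI)
  fix D D' :: movie and m n n' and C assume mv: "r_move D D' m n n'" and C: "C \<in> colorings Q R D"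
  then obtain u A p L L' B where D: "D = (u, A @ shift p L @ B)" and D': "D' = (u, A @ shift p L' @ B)"
    and LL: "r_sides L L' \<or> r_sides L' L" and dia: "diagram D" "diagram D'"
    and mn: "m = length A" "n = length (shift p L)" "n' = length (shift p L')"
    by (auto simp: r_move_def)
  define S S' where "S = shift p L" and "S' = shift p L'"
  define w where "w = fold after A u"
  have comp: "composable w S" "composable w S'"
    using dia by (simp_all add: D D' S_def S'_def w_def diagram_def composable_append)
  have ends: "fold after S w = fold after S' w"
    using LL comp r_sides_ends[of L L' w p] r_sides_ends[of L' L w p] by (auto simp: S_def S'_def)
  define W where "W = rows D C"
  have W: "W \<in> films Q R D" using rows_in_films[OF dia(1) C] by (simp add: W_def)
  then have len: "length W = Suc (length A + length S + length B)"
    by (simp add: W_def D S_def)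
  define V where "V = take (Suc (length S)) (drop (length A) W)"
  have fW: "film Q R A (take (Suc (length A)) W)" "film Q R S V"
     "film Q R B (drop (length A + length S) W)"
    using W by (simp_all add: films_def D film_append S_def V_def add.commute)
  have V0: "hd V = W ! length A" using len by (simp add: V_def hd_drop_conv_nth hd_take)
  have V1: "last V = W ! (length A + length S)"
    using len by (simp add: V_def last_conv_nth)
  have "length (W ! length A) = length w"
    using film_row_length[OF dia(1) W, of "length A"] strands_below[of "length A" A u "S @ B"]
    by (simp add: D w_def S_def)
  then have "V \<in> films Q R (w, S)" using fW by (simp add: films_def V0)
  moreover have "unique_refill Q R w S S'" using assms[OF LL] comp by (simp add: S_def S'_def)
  ultimately have "\<exists>!V'. V' \<in> films Q R (w, S') \<and> hd V' = hd V \<and> last V' = last V"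
    by (simp add: unique_refill_def)
  then obtain V' where V': "V' \<in> films Q R (w, S')" "hd V' = hd V" "last V' = last V"
    and uniq: "\<And>V''. V'' \<in> films Q R (w, S') \<Longrightarrow> hd V'' = hd V \<Longrightarrow> last V'' = last V \<Longrightarrow> V'' = V'"
    by blast
  have lenV': "length V' = Suc (length S')" using V' by (simp add: films_def film_def)
  define W' where "W' = take (length A) W @ V' @ drop (Suc (length A + length S)) W"
  note refill = refill_film[OF len lenV' V'(2)[unfolded V0] V'(3)[unfolded V1], folded W'_def]
  have W'film: "W' \<in> films Q R D'"
  proof -
    have "film Q R (A @ S' @ B) W'"
      using fW V' refill by (simp add: film_append films_def add.commute)
    moreover have "hd W' = hd W"
      using refill(1) by (metis hd_take zero_less_Suc)
    ultimately show ?thesis using W by (simp add: films_def D D' S'_def)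
  qed
  have W'out: "agree_outside m n n' W W'"
    using refill by (simp add: agree_outside_def mn S_def S'_def)
  have W'uniq: "X = W'" if X: "X \<in> films Q R D'" "agree_outside m n n' W X" for X
  proof -
    define U where "U = take (Suc (length S')) (drop (length A) X)"
    have lenX: "length X = Suc (length A + length S' + length B)"
      using X by (simp add: films_def film_def D' S'_def)
    have out: "take (Suc (length A)) X = take (Suc (length A)) W"
      "drop (length A + length S') X = drop (length A + length S) W"
      using X by (simp_all add: agree_outside_def mn S_def S'_def)
    have nth: "X ! length A = W ! length A" "X ! (length A + length S') = W ! (length A + length S)"
      using out(1) len lenX arg_cong[OF out(2), of hd]
      by (simp_all add: hd_drop_conv_nth take_Suc_conv_app_nth)
    have "film Q R S' U" using X by (simp add: films_def D' film_append S'_def U_def)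
    moreover have "hd U = hd V" "last U = last V"
      using lenX nth by (simp_all add: U_def V0 V1 hd_drop_conv_nth hd_take last_conv_nth)
    moreover have "length (hd V) = length w" using V' by (simp add: films_def)
    ultimately have "U = V'" by (intro uniq) (simp_all add: films_def)
    moreover have "X = take (length A) X @ U @ drop (Suc (length A + length S')) X"
      by (simp add: U_def) (metis append_take_drop_id add.commute add_Suc_right drop_drop)
    moreover have "take (length A) X = take (length A) W"
      using arg_cong[OF out(1), of "take (length A)"] by simp
    moreover have "drop (Suc (length A + length S')) X = drop (Suc (length A + length S)) W"
      using arg_cong[OF out(2), of "drop 1"] by simp
    ultimately show ?thesis by (simp add: W'_def)
  qed
  have coin: "coincide_outside D D' m n n' C C' \<longleftrightarrow> agree_outside m n n' W (rows D' C')" for C'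
    using coincide_outside_rows[OF ends[unfolded w_def], of D B D' C C'] D D'
    by (simp add: mn S_def S'_def W_def)
  obtain C' where C': "C' \<in> colorings Q R D'" "rows D' C' = W'"
    using film_is_rows[OF dia(2) W'film] by blast
  show "\<exists>!C'. C' \<in> colorings Q R D' \<and> coincide_outside D D' m n n' C C'"
  proof (rule ex1I[of _ C'])
    show "C' \<in> colorings Q R D' \<and> coincide_outside D D' m n n' C C'"
      using C' W'out by (simp add: coin)
    fix C'' assume C'': "C'' \<in> colorings Q R D' \<and> coincide_outside D D' m n n' C C''"
    then have "rows D' C'' = W'"
      using rows_in_films[OF dia(2)] by (intro W'uniq) (auto simp: coin)
    then show "C'' = C'" using rows_inj[of C'' Q R D' C'] C'' C' by simp
  qed
qed

text \<open>
  Conversely, each side of an R-move is a diagram itself, so the topological property may be used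
  with nothing outside the ball.
\<close>

lemma refill_if_topological:
  assumes top: "topological Q R" and LL: "r_sides L L' \<or> r_sides L' L"
    and comp: "composable u L" "composable u L'"
    and V: "film Q R L V" "length (hd V) = length u"
  obtains V' where "film Q R L' V'" "hd V' = hd V" "last V' = last V"
proof -
  let ?D = "(u, L)" and ?D' = "(u, L')"
  have dia: "diagram ?D" "diagram ?D'" using comp by (simp_all add: diagram_def)
  have sh: "shift 0 L = L" for L by (induction L) auto
  have mv: "r_move ?D ?D' 0 (length L) (length L')"
    unfolding r_move_def
    by (intro conjI dia exI[of _ u] exI[of _ "[]"] exI[of _ 0] exI[of _ L] exI[of _ L'] LL)
      (simp_all add: sh)
  have "V \<in> films Q R ?D" using V by (simp add: films_def)
  then obtain C where C: "C \<in> colorings Q R ?D" "rows ?D C = V" using film_is_rows[OF dia(1)] by blast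
  then obtain C' where C': "C' \<in> colorings Q R ?D'" "coincide_outside ?D ?D' 0 (length L) (length L') C C'"
    using top mv unfolding topological_def by blast
  have "fold after L u = fold after L' u"
    using LL comp r_sides_same_top by metis
  then have out: "agree_outside 0 (length L) (length L') V (rows ?D' C')"
    using coincide_outside_rows[of L "[]" u L' ?D "[]" ?D' C C'] C C' by simp
  have V': "film Q R L' (rows ?D' C')" using rows_in_films[OF dia(2) C'(1)] by (simp add: films_def)
  have len: "length V = Suc (length L)" using V by (simp add: film_def)
  have "hd (rows ?D' C') = hd V"
    using out unfolding agree_outside_def by (metis hd_take zero_less_Suc)
  moreover have "last (rows ?D' C') = last V"
    using out len unfolding agree_outside_def
    by (metis add_0 last_drop length_rows lessI snd_conv)
  ultimately show thesis using V' that by blast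
qed

section \<open>Colors in single layers\<close>

lemma step_append:
  "step Q R (length x + q, g) (x @ w) v \<longleftrightarrow>
     set x \<subseteq> Q \<and> (\<exists>v'. v = x @ v' \<and> step Q R (q, g) w v')"
  (is "?L \<longleftrightarrow> ?R")
proof
  assume L: ?L
  then have tk: "take (length x + q) v = x @ take q w" by (simp add: step.simps)
  then have "take (length x) v = x" by (metis append_eq_conv_conj take_take min.absorb1 le_add1 take_append)
  then obtain v' where v: "v = x @ v'" by (metis append_take_drop_id)
  show ?R using L by (auto simp: v step.simps add.assoc)
next
  assume ?R then show ?L by (auto simp: step.simps add.assoc)
qed

lemma step_split_prefix:
  assumes "step Q R (p, g) w v"
  obtains x w' v' where "w = x @ w'" "v = x @ v'" "length x = p" "step Q R (0, g) w' v'"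
proof -
  have "p \<le> length w" using assms by (simp add: step.simps)
  then have w: "w = take p w @ drop p w" "length (take p w) = p" by simp_all
  then obtain v' where "v = take p w @ v'" "step Q R (0, g) (drop p w) v'"
    using assms step_append[of Q R "take p w" 0 g "drop p w" v] by auto
  then show ?thesis using that w by blast
qed

lemma step_source_length: "step Q R (0, g) w v \<Longrightarrow> length (source g) \<le> length w"
  by (simp add: step.simps)

lemma step_Cons:
  "step Q R (Suc q, g) (a # w) v \<longleftrightarrow> a \<in> Q \<and> (\<exists>v'. v = a # v' \<and> step Q R (q, g) w v')"
  using step_append[of Q R "[a]" q g w v] by simp

lemma step_Cup: "step Q R (0, Cup d) w v \<longleftrightarrow> set w \<subseteq> Q \<and> (\<exists>a\<in>Q. v = a # a # w)"
  by (auto simp: step.simps Suc_le_length_iff eval_nat_numeral)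

lemma step_Cap:
  "step Q R (0, Cap d) (a # b # w) v \<longleftrightarrow> a = b \<and> a \<in> Q \<and> set w \<subseteq> Q \<and> v = w"
  by (auto simp: step.simps)

lemma step_Cross:
  "step Q R (0, Cross ov d e) (a # b # w) v \<longleftrightarrow> a \<in> Q \<and> b \<in> Q \<and> set w \<subseteq> Q \<and>
     (\<exists>a'\<in>Q. \<exists>b'\<in>Q. v = a' # b' # w \<and> (if ov then b' = a else a' = b) \<and>
        obeys_crossing R ov d e a b a' b')"
  by (auto simp: step.simps Suc_le_length_iff eval_nat_numeral)

lemma step_Merge:
  "step Q R (0, Merge d e f) (a # b # w) v \<longleftrightarrow> a \<in> Q \<and> b \<in> Q \<and> set w \<subseteq> Q \<and>
     (\<exists>c\<in>Q. v = c # w \<and> obeys_vertex R [(d = Down, a), (e = Down, b), (f = Up, c)])"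
  by (auto simp: step.simps Suc_le_length_iff eval_nat_numeral)

lemma step_Split:
  "step Q R (0, Split d e f) (c # w) v \<longleftrightarrow> c \<in> Q \<and> set w \<subseteq> Q \<and>
     (\<exists>a\<in>Q. \<exists>b\<in>Q. v = a # b # w \<and> obeys_vertex R [(d = Down, c), (f = Up, b), (e = Up, a)])"
  by (auto simp: step.simps Suc_le_length_iff eval_nat_numeral)

lemma film_Nil: "film Q R [] V \<longleftrightarrow> (\<exists>w. V = [w] \<and> set w \<subseteq> Q)"
  by (auto simp: film_def length_Suc_conv)

lemma film_Cons:
  "film Q R (l # ls) V \<longleftrightarrow> (\<exists>w V'. V = w # V' \<and> V' \<noteq> [] \<and> step Q R l w (hd V') \<and> film Q R ls V')"
proof (cases V)
  case (Cons w V')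
  have "set w \<subseteq> Q \<and> set v \<subseteq> Q" if "step Q R l w v" for v
    using that by (cases l) (simp add: step.simps)
  then show ?thesis
    by (cases V') (auto simp: Cons film_def All_less_Suc2)
qed (simp add: film_def)

text \<open>
  The relation between bottom and top colors induced by a list of layers. The existence half of the
  topological property says that both sides of an R-move induce the same relation; unlike films,
  relations can be computed layer by layer.
\<close>

definition reach :: "'q set \<Rightarrow> 'q coloring_rules \<Rightarrow> layer list \<Rightarrow> 'q list \<Rightarrow> 'q list \<Rightarrow> bool" where
  "reach Q R ls w v \<longleftrightarrow> (\<exists>V. film Q R ls V \<and> hd V = w \<and> last V = v)"

lemma reach_Nil: "reach Q R [] w v \<longleftrightarrow> set w \<subseteq> Q \<and> v = w"
  by (auto simp: reach_def film_Nil intro!: exI[of _ "[w]"])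

lemma reach_Cons: "reach Q R (l # ls) w v \<longleftrightarrow> (\<exists>x. step Q R l w x \<and> reach Q R ls x v)"
proof
  assume "reach Q R (l # ls) w v"
  then obtain V where "film Q R ls V" "V \<noteq> []" "step Q R l w (hd V)" "last V = v"
    by (auto simp: reach_def film_Cons)
  then show "\<exists>x. step Q R l w x \<and> reach Q R ls x v" unfolding reach_def by blast
next
  assume "\<exists>x. step Q R l w x \<and> reach Q R ls x v"
  then obtain V where "film Q R ls V" "step Q R l w (hd V)" "last V = v"
    by (auto simp: reach_def)
  then show "reach Q R (l # ls) w v"
    unfolding reach_def film_Cons
    by (intro exI[of _ "w # V"]) (auto simp: film_def)
qed

lemma film_shift:
  assumes "length x = p"
  shows "film Q R (shift p L) (map ((@) x) V) \<longleftrightarrow> (film Q R L V \<and> set x \<subseteq> Q)"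
  unfolding assms[symmetric]
proof (induction L arbitrary: V)
  case Nil
  show ?case by (auto simp: film_Nil)
next
  case (Cons l L)
  obtain q g where l: "l = (q, g)" by fastforce
  show ?case
    by (cases V) (auto simp: l film_Cons Cons step_append hd_map)
qed

lemma film_shift_split:
  assumes "length x = p" "film Q R (shift p L) V" "hd V = x @ w"
  shows "\<exists>V'. V = map ((@) x) V' \<and> hd V' = w"
  using assms(2,3)
proof (induction L arbitrary: V w)
  case Nil
  then show ?case by (auto simp: film_Nil intro!: exI[of _ "[w]"])
next
  case (Cons l L)
  obtain q g where l: "l = (q, g)" by fastforce
  obtain V1 where V: "V = (x @ w) # V1" and st: "step Q R (length x + q, g) (x @ w) (hd V1)"
    and f: "film Q R (shift p L) V1"
    using Cons.prems assms(1) by (auto simp: l film_Cons)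
  from st obtain v where "hd V1 = x @ v" by (auto simp: step_append)
  then obtain V2 where "V1 = map ((@) x) V2" using Cons.IH[OF f] by blast
  then show ?case by (auto simp: V intro!: exI[of _ "w # V2"])
qed

lemma film_not_Nil: "film Q R L V \<Longrightarrow> V \<noteq> []"
  by (auto simp: film_def)

text \<open>
  Strands to the left of the ball keep their colors and can be removed.
\<close>

lemma unique_refill_shift:
  assumes refill: "\<And>u. composable u L \<Longrightarrow> composable u L' \<Longrightarrow> unique_refill Q R u L L'"
    and comp: "composable u (shift p L)" "composable u (shift p L')" and ne: "L \<noteq> [] \<or> L' \<noteq> []"
  shows "unique_refill Q R u (shift p L) (shift p L')"
  unfolding unique_refill_def
proof
  obtain x u0 where u: "u = x @ u0" "length x = p"
    using ne composable_shift_split comp by metis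
  have comp0: "composable u0 L" "composable u0 L'"
    using comp by (auto simp: u(1) composable_shift simp flip: u(2))
  fix V assume V: "V \<in> films Q R (u, shift p L)"
  define y w where "y = take p (hd V)" and "w = drop p (hd V)"
  have y: "length y = p" "length w = length u0" and yw: "hd V = y @ w"
    using V u by (simp_all add: films_def y_def w_def)
  have fV: "film Q R (shift p L) V" using V by (simp add: films_def)
  obtain V0 where V0: "V = map ((@) y) V0" "hd V0 = w"
    using film_shift_split[OF y(1) fV yw] by blast
  have f0: "film Q R L V0" "set y \<subseteq> Q" using fV by (simp_all add: V0(1) film_shift[OF y(1)])
  have "V0 \<in> films Q R (u0, L)" using f0 V0 y by (simp add: films_def)
  then have "\<exists>!V'. V' \<in> films Q R (u0, L') \<and> hd V' = hd V0 \<and> last V' = last V0"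
    using refill[OF comp0] by (simp add: unique_refill_def)
  then obtain V' where V': "V' \<in> films Q R (u0, L')" "hd V' = w" "last V' = last V0"
    and uniq: "\<And>U. U \<in> films Q R (u0, L') \<Longrightarrow> hd U = w \<Longrightarrow> last U = last V0 \<Longrightarrow> U = V'"
    using V0(2) by blast
  have f': "film Q R L' V'" using V' by (simp add: films_def)
  note ne0 = film_not_Nil[OF f'] film_not_Nil[OF f0(1)]
  show "\<exists>!V'. V' \<in> films Q R (u, shift p L') \<and> hd V' = hd V \<and> last V' = last V"
  proof (rule ex1I[of _ "map ((@) y) V'"])
    show "map ((@) y) V' \<in> films Q R (u, shift p L') \<and> hd (map ((@) y) V') = hd V \<and>
        last (map ((@) y) V') = last V"
      using f' f0 V' V0 ne0 y u by (simp add: films_def film_shift hd_map last_map)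
    fix X assume X: "X \<in> films Q R (u, shift p L') \<and> hd X = hd V \<and> last X = last V"
    then have fX: "film Q R (shift p L') X" by (simp add: films_def)
    obtain X0 where X0: "X = map ((@) y) X0" "hd X0 = w"
      using film_shift_split[OF y(1) fX] X yw by metis
    have fX0: "film Q R L' X0" using fX by (simp add: X0(1) film_shift[OF y(1)])
    have "last X0 = last V0"
      using X film_not_Nil[OF fX0] ne0 by (simp add: X0(1) V0(1) last_map)
    then have "X0 = V'"
      using fX0 y X0 by (intro uniq) (simp_all add: films_def)
    then show "X = map ((@) y) V'" by (simp add: X0(1))
  qed
qed

lemma unique_refillI:
  assumes ex: "\<And>w v. set w \<subseteq> Q \<Longrightarrow> length w = length u \<Longrightarrow> reach Q R L w v \<Longrightarrow> reach Q R L' w v"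
    and uniq: "\<And>V V'. film Q R L' V \<Longrightarrow> film Q R L' V' \<Longrightarrow> length (hd V) = length u \<Longrightarrow>
      hd V = hd V' \<Longrightarrow> last V = last V' \<Longrightarrow> V = V'"
  shows "unique_refill Q R u L L'"
  unfolding unique_refill_def
proof
  fix V assume V: "V \<in> films Q R (u, L)"
  then have "reach Q R L (hd V) (last V)" "set (hd V) \<subseteq> Q" "length (hd V) = length u"
    by (auto simp: reach_def films_def film_def)
  with ex have "reach Q R L' (hd V) (last V)" by blast
  then obtain V' where V': "film Q R L' V'" "hd V' = hd V" "last V' = last V"
    by (auto simp: reach_def)
  show "\<exists>!V'. V' \<in> films Q R (u, L') \<and> hd V' = hd V \<and> last V' = last V"
  proof (rule ex1I[of _ V'])
    show "V' \<in> films Q R (u, L') \<and> hd V' = hd V \<and> last V' = last V"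
      using V V' by (simp add: films_def)
    fix X assume "X \<in> films Q R (u, L') \<and> hd X = hd V \<and> last X = last V"
    then show "X = V'" using V' by (intro uniq) (auto simp: films_def)
  qed
qed

text \<open>
  Uniqueness of the colors inside the ball follows as soon as every layer propagates colors
  deterministically in one fixed direction, upwards here and downwards in the next lemma.
\<close>

lemma film_unique_up:
  assumes "\<And>l w v v'. l \<in> set L \<Longrightarrow> step Q R l w v \<Longrightarrow> step Q R l w v' \<Longrightarrow> v = v'"
    and "film Q R L V" "film Q R L V'" "hd V = hd V'"
  shows "V = V'"
  using assms
proof (induction L arbitrary: V V')
  case Nil
  then show ?case by (auto simp: film_Nil)
next
  case (Cons l L)
  obtain w V1 V1' where V: "V = w # V1" "V' = w # V1'" "step Q R l w (hd V1)" "step Q R l w (hd V1')"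
    "film Q R L V1" "film Q R L V1'"
    using Cons.prems(2-4) by (auto simp: film_Cons)
  have "hd V1 = hd V1'" using Cons.prems(1)[of l w "hd V1" "hd V1'"] V by simp
  then have "V1 = V1'" using Cons.IH[OF _ V(5,6)] Cons.prems(1) by (meson list.set_intros(2))
  then show ?case using V by simp
qed

lemma film_unique_down:
  assumes "\<And>l w w' v. l \<in> set L \<Longrightarrow> step Q R l w v \<Longrightarrow> step Q R l w' v \<Longrightarrow> w = w'"
    and "film Q R L V" "film Q R L V'" "last V = last V'"
  shows "V = V'"
  using assms
proof (induction L arbitrary: V V')
  case Nil
  then show ?case by (auto simp: film_Nil)
next
  case (Cons l L)
  obtain w w' V1 V1' where V: "V = w # V1" "V' = w' # V1'" "step Q R l w (hd V1)" "step Q R l w' (hd V1')"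
    "film Q R L V1" "film Q R L V1'" "V1 \<noteq> []" "V1' \<noteq> []"
    using Cons.prems(2,3) by (auto simp: film_Cons)
  have "last V1 = last V1'" using Cons.prems(4) V by simp
  then have "V1 = V1'" using Cons.IH[OF _ V(5,6)] Cons.prems(1) by (meson list.set_intros(2))
  then show ?case using V Cons.prems(1)[of l w "hd V1" w'] by simp
qed

section \<open>Actions in a squandle\<close>

lemma ex_less_3: "(\<exists>n<3. P n) \<longleftrightarrow> P 0 \<or> P 1 \<or> P (2::nat)"
  by (auto simp: numeral_3_eq_3 numeral_2_eq_2 less_Suc_eq)

lemma opp_opp [simp]: "opp (opp d) = d"
  by (cases d) auto

locale squandle_with_inverse =
  fixes Q :: "'q set" and tri itri :: "'q \<Rightarrow> 'q \<Rightarrow> 'q" and sq :: "'q \<Rightarrow> 'q"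
  assumes tri_closed [simp]: "a \<in> Q \<Longrightarrow> b \<in> Q \<Longrightarrow> tri a b \<in> Q"
    and itri_closed [simp]: "a \<in> Q \<Longrightarrow> b \<in> Q \<Longrightarrow> itri a b \<in> Q"
    and sq_closed [simp]: "a \<in> Q \<Longrightarrow> sq a \<in> Q"
    and tri_dist: "a \<in> Q \<Longrightarrow> b \<in> Q \<Longrightarrow> c \<in> Q \<Longrightarrow> tri (tri a b) c = tri (tri a c) (tri b c)"
    and itri_tri [simp]: "a \<in> Q \<Longrightarrow> b \<in> Q \<Longrightarrow> itri (tri a b) b = a"
    and tri_itri [simp]: "a \<in> Q \<Longrightarrow> b \<in> Q \<Longrightarrow> tri (itri a b) b = a"
    and tri_self [simp]: "a \<in> Q \<Longrightarrow> tri a a = a"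
    and tri_sq: "a \<in> Q \<Longrightarrow> b \<in> Q \<Longrightarrow> tri a (sq b) = tri (tri a b) b"
    and sq_tri: "a \<in> Q \<Longrightarrow> b \<in> Q \<Longrightarrow> tri (sq a) b = sq (tri a b)"
begin

abbreviation "R \<equiv> squandle_rules tri sq"

text \<open>
  \<open>act d b a\<close> is the color obtained from \<open>a\<close> by passing under a strand of color \<open>b\<close> and
  orientation \<open>d\<close> from right to left as seen by an observer looking upwards. Reversing the
  over-strand inverts the operation, so statements about \<open>act\<close> treat all orientations at once.
\<close>

fun act :: "dir \<Rightarrow> 'q \<Rightarrow> 'q \<Rightarrow> 'q" where
  "act Up b a = tri a b"
| "act Down b a = itri a b"

lemma act_closed [simp]: "a \<in> Q \<Longrightarrow> b \<in> Q \<Longrightarrow> act d b a \<in> Q"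
  by (cases d) auto

lemma act_inverse [simp]:
  "a \<in> Q \<Longrightarrow> b \<in> Q \<Longrightarrow> act (opp d) b (act d b a) = a"
  "a \<in> Q \<Longrightarrow> b \<in> Q \<Longrightarrow> act d b (act (opp d) b a) = a"
  by (cases d; simp)+

lemma act_inj: "a \<in> Q \<Longrightarrow> a' \<in> Q \<Longrightarrow> b \<in> Q \<Longrightarrow> act d b a = act d b a' \<longleftrightarrow> a = a'"
  by (metis act_inverse(1))

lemma act_self [simp]: "a \<in> Q \<Longrightarrow> act d a a = a"
  by (cases d) (simp, metis act.simps(2) itri_tri tri_self)

text \<open>
  Self-distributivity says that each \<open>tri _ c\<close> is an automorphism; then so is its inverse, and
  automorphisms respect the inverse operation too. This covers all orientations in move III.
\<close>

lemma act_dist: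
  assumes "a \<in> Q" "b \<in> Q" "c \<in> Q"
  shows "act d c (act e b a) = act e (act d c b) (act d c a)"
proof -
  have up: "act Up c (act e b a) = act e (act Up c b) (act Up c a)" if "a \<in> Q" "b \<in> Q" for a b
  proof (cases e)
    case Up then show ?thesis using that assms tri_dist[of a b c] by simp
  next
    case Down
    have "tri (tri (itri a b) c) (tri b c) = tri a c"
      using that assms tri_dist[of "itri a b" b c] by simp
    then show ?thesis
      using that assms Down itri_tri[of "tri (itri a b) c" "tri b c"] by simp
  qed
  show ?thesis
  proof (cases d)
    case Up then show ?thesis using up assms by simp
  next
    case Down
    have "act Up c (act e (act Down c b) (act Down c a)) = act e b a"
      using up[of "act Down c a" "act Down c b"] assms by simp
    then show ?thesis
      using Down assms act_inverse(1)[of "act e (act Down c b) (act Down c a)" c Up] by simp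
  qed
qed

text \<open>
  Distributivity with one of the actions of \<open>c\<close> moved to the other side of the equation. Move III
  takes these forms when the top strand starts between the other two: they pass under it in opposite
  directions.
\<close>

lemma act_dist_inverse:
  assumes "a \<in> Q" "b \<in> Q" "c \<in> Q"
  shows "act d c (act e b (act (opp d) c a)) = act e (act d c b) a"
    "act (opp d) c (act e b (act d c a)) = act e (act (opp d) c b) a"
    "act d c (act e (act (opp d) c b) a) = act e b (act d c a)"
    "act (opp d) c (act e (act d c b) a) = act e b (act (opp d) c a)"
  using assms act_dist[of "act (opp d) c a" b c d e] act_dist[of "act d c a" b c "opp d" e]
    act_dist[of a "act (opp d) c b" c d e] act_dist[of a "act d c b" c "opp d" e] by simp_all

lemma act_sq:
  assumes "a \<in> Q" "b \<in> Q"
  shows "act d (sq b) a = act d b (act d b a)"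
proof (cases d)
  case Up then show ?thesis using assms tri_sq by simp
next
  case Down
  have "tri (itri (itri a b) b) (sq b) = a" using assms tri_sq[of "itri (itri a b) b" b] by simp
  then show ?thesis using Down assms itri_tri[of "itri (itri a b) b" "sq b"] by simp
qed

lemma sq_act:
  assumes "a \<in> Q" "b \<in> Q"
  shows "act d b (sq a) = sq (act d b a)"
proof (cases d)
  case Up then show ?thesis using assms sq_tri by simp
next
  case Down
  have "tri (sq (itri a b)) b = sq a" using assms sq_tri[of "itri a b" b] by simp
  then show ?thesis using Down assms itri_tri[of "sq (itri a b)" b] by simp
qed

text \<open>
  The coloring rule at a vertex with lower legs \<open>a\<close>, \<open>b\<close> and upper leg \<open>c\<close>. The squared color sits
  on the leg that is alone in its in/out class: the upper leg if both lower legs have the same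
  orientation, otherwise the lower leg oriented like the upper one.
\<close>

definition vertex :: "dir \<Rightarrow> dir \<Rightarrow> dir \<Rightarrow> 'q \<Rightarrow> 'q \<Rightarrow> 'q \<Rightarrow> bool" where
  "vertex d e f a b c \<longleftrightarrow>
     (if d = e then b = a \<and> c = sq a else if f = d then a = sq b \<and> c = b else b = sq a \<and> c = a)"

lemma obeys_Merge:
  assumes "well_oriented (Merge d e f)"
  shows "obeys_vertex R [(d = Down, a), (e = Down, b), (f = Up, c)] \<longleftrightarrow> vertex d e f a b c"
  using assms
  by (cases d; cases e; cases f)
    (auto simp: well_oriented_def obeys_vertex_def ex_less_3 vertex_def squandle_rules_def
      numeral_2_eq_2)

text \<open>
  A split read upside down is a merge. Turning it around exchanges zip and unzip vertices, which
  have the same rule.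
\<close>

lemma obeys_Split:
  assumes "well_oriented (Split d e f)"
  shows "obeys_vertex R [(d = Down, c), (f = Up, b), (e = Up, a)] \<longleftrightarrow> vertex e f d a b c"
  using assms
  by (cases d; cases e; cases f)
    (auto simp: well_oriented_def obeys_vertex_def ex_less_3 vertex_def squandle_rules_def
      numeral_2_eq_2)

text \<open>
  A crossing determines its upper colors from the lower ones. At a crossing where the strand going
  to the top left is above, the other strand passes under it from left to right, whence the
  opposite orientation.
\<close>

lemma step_crossing:
  "step Q R (0, Cross ov d e) (a # b # w) v \<longleftrightarrow> a \<in> Q \<and> b \<in> Q \<and> set w \<subseteq> Q \<and>
     v = (if ov then act d a b # a # w else b # act (opp e) b a # w)"
  unfolding step_Cross
  by (cases ov; cases d; cases e) (auto simp: squandle_rules_def)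

lemma step_merge:
  assumes "well_oriented (Merge d e f)"
  shows "step Q R (0, Merge d e f) (a # b # w) v \<longleftrightarrow> a \<in> Q \<and> b \<in> Q \<and> set w \<subseteq> Q \<and>
     (\<exists>c\<in>Q. v = c # w \<and> vertex d e f a b c)"
  by (simp add: step_Merge obeys_Merge[OF assms])

lemma step_split:
  assumes "well_oriented (Split d e f)"
  shows "step Q R (0, Split d e f) (c # w) v \<longleftrightarrow> c \<in> Q \<and> set w \<subseteq> Q \<and>
     (\<exists>a\<in>Q. \<exists>b\<in>Q. v = a # b # w \<and> vertex e f d a b c)"
  by (simp add: step_Split obeys_Split[OF assms])

text \<open>
  Move VI: as \<open>tri _ x\<close> and its inverse commute with squaring, a strand of color \<open>x\<close> that passes over
  all the legs of a vertex preserves the vertex rule.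
\<close>

lemma vertex_over:
  assumes "a \<in> Q" "b \<in> Q" "c \<in> Q" "x \<in> Q"
  shows "vertex d e f (act s x a) (act s x b) (act s x c) \<longleftrightarrow> vertex d e f a b c"
  using assms by (simp add: vertex_def act_inj flip: sq_act)

text \<open>
  Move IV: passing under both lower legs has the same effect as passing under the upper one. If the
  upper leg carries \<open>sq a\<close>, this is the law for the action of a square; otherwise the
  actions of \<open>sq a\<close> and \<open>a\<close> on one side have opposite directions, and one action of \<open>a\<close> is left.
\<close>

lemma vertex_under:
  assumes "vertex d e f a b c" "a \<in> Q" "b \<in> Q" "c \<in> Q" "x \<in> Q"
    "d = e \<longrightarrow> f = d"
  shows "act d a (act e b x) = act f c x" "act (opp e) b (act (opp d) a x) = act (opp f) c x"
  using assms tri_sq act_sq[of _ _ Down]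
  by (cases d; cases e; cases f; force simp: vertex_def)+

text \<open>
  Move V: the legs of a vertex carry the colors \<open>a\<close> and \<open>sq a\<close>, which act trivially on each other
  and on themselves, since \<open>a\<close> acts trivially on itself. So a crossing merely exchanges the colors of
  two legs.
\<close>

lemma vertex_cross:
  assumes "a \<in> Q" "b \<in> Q" "c \<in> Q"  "d = e \<longrightarrow> f = d"
  shows "vertex e d f (act d a b) a c \<longleftrightarrow> vertex d e f a b c"
    "vertex e d f b (act (opp e) b a) c \<longleftrightarrow> vertex d e f a b c"
proof -
  \<comment> \<open>Both are needed to recover a trivial action from the colors after the crossing: a
    square acts trivially on its root, and an element that is moved to \<open>z\<close> by \<open>x\<close> is \<open>z\<close> if \<open>x\<close> fixes \<open>z\<close>.\<close>
  have sq_self: "act d (sq y) y = y" if "y \<in> Q" for d y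
    using that act_sq[of y y d] by simp
  have cancel: "y = z" if "act d x y = z" "act d x z = z" "x \<in> Q" "y \<in> Q" "z \<in> Q" for d x y z
    using that act_inj by metis
  show "vertex e d f (act d a b) a c \<longleftrightarrow> vertex d e f a b c"
  proof (cases "d = e")
    case True
    then show ?thesis using assms cancel[of d a b a] by (auto simp: vertex_def)
  next
    case False
    show ?thesis
    proof (cases "f = d")
      case True
      then show ?thesis using False assms sq_self[of b d] sq_self[of c d] cancel[of d a b c]
        by (auto simp: vertex_def)
    next
      case f: False
      then have "f = e" using False by (cases d; cases e; cases f) auto
      then show ?thesis using False f assms sq_act[of a a d] cancel[of d a b "sq a"]
        by (auto simp: vertex_def)
    qed
  qed
  show "vertex e d f b (act (opp e) b a) c \<longleftrightarrow> vertex d e f a b c"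
  proof (cases "d = e")
    case True
    then show ?thesis using assms cancel[of "opp e" b a b] by (auto simp: vertex_def)
  next
    case False
    show ?thesis
    proof (cases "f = d")
      case True
      then show ?thesis using False assms sq_act[of b b "opp e"] cancel[of "opp e" b a "sq b"]
        by (auto simp: vertex_def)
    next
      case f: False
      then have "f = e" using False by (cases d; cases e; cases f) auto
      then show ?thesis using False f assms sq_self[of a "opp e"] sq_self[of c "opp e"] cancel[of "opp e" b a c]
        by (auto simp: vertex_def)
    qed
  qed
qed

end

section \<open>Invariance under each R-move\<close>

lemma composable_well_oriented: "composable u L \<Longrightarrow> (p, g) \<in> set L \<Longrightarrow> well_oriented g"
  by (induction L arbitrary: u) auto

lemma reach_cup:
  "reach Q R ((0, Cup d) # ls) w v \<longleftrightarrow> set w \<subseteq> Q \<and> (\<exists>a\<in>Q. reach Q R ls (a # a # w) v)"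
  "reach Q R ((Suc 0, Cup d) # ls) (x # w) v \<longleftrightarrow>
     x \<in> Q \<and> set w \<subseteq> Q \<and> (\<exists>a\<in>Q. reach Q R ls (x # a # a # w) v)"
  by (auto simp: reach_Cons step_Cons step_Cup)

lemma reach_cap:
  "reach Q R ((0, Cap d) # ls) (a # b # w) v \<longleftrightarrow>
     a = b \<and> a \<in> Q \<and> set w \<subseteq> Q \<and> reach Q R ls w v"
  "reach Q R ((Suc 0, Cap d) # ls) (x # a # b # w) v \<longleftrightarrow>
     x \<in> Q \<and> a = b \<and> a \<in> Q \<and> set w \<subseteq> Q \<and> reach Q R ls (x # w) v"
  by (auto simp: reach_Cons step_Cons step_Cap)

context squandle_with_inverse
begin

lemma crossing_up_unique:
  assumes "step Q R (p, Cross ov d e) w v" "step Q R (p, Cross ov d e) w v'"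
  shows "v = v'"
proof -
  obtain x w0 v0 where "w = x @ w0" "v = x @ v0" "length x = p" and st: "step Q R (0, Cross ov d e) w0 v0"
    using step_split_prefix[OF assms(1)] .
  moreover then obtain a b z where "w0 = a # b # z"
    using step_source_length[OF st] by (auto simp: Suc_le_length_iff)
  ultimately show ?thesis
    using st assms(2) step_append[of Q R x 0 "Cross ov d e" w0 v'] by (auto simp: step_crossing)
qed

lemma crossing_down_unique:
  assumes "step Q R (p, Cross ov d e) w v" "step Q R (p, Cross ov d e) w' v"
  shows "w = w'"
proof -
  obtain x w0 v0 where 1: "w = x @ w0" "v = x @ v0" "length x = p" "step Q R (0, Cross ov d e) w0 v0"
    using step_split_prefix[OF assms(1)] .
  obtain x' w1 v1 where 2: "w' = x' @ w1" "v = x' @ v1" "length x' = p" "step Q R (0, Cross ov d e) w1 v1"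
    using step_split_prefix[OF assms(2)] .
  have xx: "x' = x" "v1 = v0" using 1 2 by auto
  obtain a b z where w0: "w0 = a # b # z"
    using step_source_length[OF 1(4)] by (auto simp: Suc_le_length_iff)
  obtain a' b' z' where w1: "w1 = a' # b' # z'"
    using step_source_length[OF 2(4)] by (auto simp: Suc_le_length_iff)
  have "w0 = w1" using 1(4) 2(4) by (auto simp: step_crossing w0 w1 xx act_inj split: if_splits)
  then show ?thesis by (simp add: 1 2 xx)
qed

lemma merge_up_unique:
  assumes "well_oriented (Merge d e f)"
    and "step Q R (p, Merge d e f) w v" "step Q R (p, Merge d e f) w v'"
  shows "v = v'"
proof -
  obtain x w0 v0 where "w = x @ w0" "v = x @ v0" "length x = p" and st: "step Q R (0, Merge d e f) w0 v0"
    using step_split_prefix[OF assms(2)] .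
  moreover then obtain a b z where "w0 = a # b # z"
    using step_source_length[OF st] by (auto simp: Suc_le_length_iff)
  ultimately show ?thesis
    using st assms(3) step_append[of Q R x 0 "Merge d e f" w0 v']
    by (auto simp: step_merge[OF assms(1)] vertex_def split: if_splits)
qed

lemma split_down_unique:
  assumes wo: "well_oriented (Split d e f)"
    and "step Q R (p, Split d e f) w v" "step Q R (p, Split d e f) w' v"
  shows "w = w'"
proof -
  obtain x w0 v0 where 1: "w = x @ w0" "v = x @ v0" "length x = p" "step Q R (0, Split d e f) w0 v0"
    using step_split_prefix[OF assms(2)] .
  obtain x' w1 v1 where 2: "w' = x' @ w1" "v = x' @ v1" "length x' = p" "step Q R (0, Split d e f) w1 v1"
    using step_split_prefix[OF assms(3)] .
  have xx: "x' = x" "v1 = v0" using 1 2 by auto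
  obtain c z where w0: "w0 = c # z"
    using step_source_length[OF 1(4)] by (auto simp: Suc_le_length_iff)
  obtain c' z' where w1: "w1 = c' # z'"
    using step_source_length[OF 2(4)] by (auto simp: Suc_le_length_iff)
  have "w0 = w1"
    using 1(4) 2(4) by (auto simp: step_split[OF wo] w0 w1 xx vertex_def split: if_splits)
  then show ?thesis by (simp add: 1 2 xx)
qed

text \<open>
  The pieces for which the colors below determine those above: at a merge the two lower colors
  determine the upper one. Splits have this property upside down only.
\<close>

fun up_unique :: "piece \<Rightarrow> bool" where
  "up_unique (Cross ov d e) = True"
| "up_unique (Merge d e f) = True"
| "up_unique _ = False"

fun down_unique :: "piece \<Rightarrow> bool" where
  "down_unique (Cross ov d e) = True"
| "down_unique (Split d e f) = True"
| "down_unique _ = False"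

lemma film_unique_if_up_unique:
  assumes "composable u L" "\<And>p g. (p, g) \<in> set L \<Longrightarrow> up_unique g"
    and "film Q R L V" "film Q R L V'" "hd V = hd V'"
  shows "V = V'"
proof (rule film_unique_up[OF _ assms(3-5)])
  fix l w v v' assume l: "l \<in> set L" and st: "step Q R l w v" "step Q R l w v'"
  obtain p g where pg: "l = (p, g)" by fastforce
  then have "up_unique g" "well_oriented g"
    using assms(1,2) l composable_well_oriented by auto
  then show "v = v'"
    using st crossing_up_unique merge_up_unique by (cases g) (auto simp: pg)
qed

lemma film_unique_if_down_unique:
  assumes "composable u L" "\<And>p g. (p, g) \<in> set L \<Longrightarrow> down_unique g"
    and "film Q R L V" "film Q R L V'" "last V = last V'"
  shows "V = V'"
proof (rule film_unique_down[OF _ assms(3-5)])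
  fix l w w' v assume l: "l \<in> set L" and st: "step Q R l w v" "step Q R l w' v"
  obtain p g where pg: "l = (p, g)" by fastforce
  then have "down_unique g" "well_oriented g"
    using assms(1,2) l composable_well_oriented by auto
  then show "w = w'"
    using st crossing_down_unique split_down_unique by (cases g) (auto simp: pg)
qed

lemma act_eq_self: "a \<in> Q \<Longrightarrow> x \<in> Q \<Longrightarrow> act d x a = x \<longleftrightarrow> a = x"
  and eq_act_self: "a \<in> Q \<Longrightarrow> x \<in> Q \<Longrightarrow> x = act d x a \<longleftrightarrow> a = x"
  using act_inj[of a x x d] by auto

lemma reach_crossing:
  "reach Q R ((0, Cross ov d e) # ls) (a # b # w) v \<longleftrightarrow> a \<in> Q \<and> b \<in> Q \<and> set w \<subseteq> Q \<and>
     reach Q R ls (if ov then act d a b # a # w else b # act (opp e) b a # w) v"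
  "reach Q R ((Suc 0, Cross ov d e) # ls) (x # a # b # w) v \<longleftrightarrow>
     x \<in> Q \<and> a \<in> Q \<and> b \<in> Q \<and> set w \<subseteq> Q \<and>
     reach Q R ls (x # (if ov then act d a b # a # w else b # act (opp e) b a # w)) v"
  by (auto simp: reach_Cons step_Cons step_crossing)

lemma reach_merge:
  assumes "well_oriented (Merge d e f)"
  shows "reach Q R ((0, Merge d e f) # ls) (a # b # w) v \<longleftrightarrow> a \<in> Q \<and> b \<in> Q \<and> set w \<subseteq> Q \<and>
     (\<exists>c\<in>Q. vertex d e f a b c \<and> reach Q R ls (c # w) v)"
  "reach Q R ((Suc 0, Merge d e f) # ls) (x # a # b # w) v \<longleftrightarrow>
     x \<in> Q \<and> a \<in> Q \<and> b \<in> Q \<and> set w \<subseteq> Q \<and>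
     (\<exists>c\<in>Q. vertex d e f a b c \<and> reach Q R ls (x # c # w) v)"
  by (auto simp: reach_Cons step_Cons step_merge[OF assms])

lemma reach_split:
  assumes "well_oriented (Split d e f)"
  shows "reach Q R ((0, Split d e f) # ls) (c # w) v \<longleftrightarrow> c \<in> Q \<and> set w \<subseteq> Q \<and>
     (\<exists>a\<in>Q. \<exists>b\<in>Q. vertex e f d a b c \<and> reach Q R ls (a # b # w) v)"
  "reach Q R ((Suc 0, Split d e f) # ls) (x # c # w) v \<longleftrightarrow> x \<in> Q \<and> c \<in> Q \<and> set w \<subseteq> Q \<and>
     (\<exists>a\<in>Q. \<exists>b\<in>Q. vertex e f d a b c \<and> reach Q R ls (x # a # b # w) v)"
  by (auto simp: reach_Cons step_Cons step_split[OF assms])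

lemmas reach_simps = reach_Nil reach_cup reach_cap reach_crossing

text \<open>
  In move I the cap forces the loop to carry the color of the strand: a strand that acts on some
  color and yields its own color must have met its own color. As a cup does not propagate colors in
  any direction, uniqueness is obtained here by computing the films.
\<close>

lemma kink_right_films:
  assumes "film Q R [(1, Cup d), (0, Cross ov d d), (1, Cap d)] V" "hd V = a # z"
  shows "V = [a # z, a # a # a # z, a # a # a # z, a # z]"
  using assms
  by (cases ov) (auto simp: film_Cons film_Nil step_Cons step_Cup step_Cap step_crossing act_eq_self eq_act_self)

lemma kink_left_films:
  assumes "film Q R [(0, Cup (opp d)), (1, Cross ov d d), (0, Cap (opp d))] V" "hd V = a # z"
  shows "V = [a # z, a # a # a # z, a # a # a # z, a # z]"
  using assms
  by (cases ov) (auto simp: film_Cons film_Nil step_Cons step_Cup step_Cap step_crossing act_eq_self eq_act_self)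

lemma reach_kink_right:
  "reach Q R [(1, Cup d), (0, Cross ov d d), (1, Cap d)] (a # z) v \<longleftrightarrow> reach Q R [] (a # z) v"
  by (cases ov) (auto simp: reach_simps act_eq_self eq_act_self)

lemma reach_kink_left:
  "reach Q R [(0, Cup (opp d)), (1, Cross ov d d), (0, Cap (opp d))] (a # z) v \<longleftrightarrow>
     reach Q R [] (a # z) v"
  by (cases ov) (auto simp: reach_simps act_eq_self eq_act_self)

lemma reach_II:
  "reach Q R [(0, Cross ov d e), (0, Cross (\<not> ov) e d)] (a # b # z) v \<longleftrightarrow>
     reach Q R [] (a # b # z) v"
  by (cases ov) (auto simp: reach_simps)

lemma reach_III:
  assumes "\<not> (o12 \<and> o23 \<and> \<not> o13)" "\<not> (\<not> o12 \<and> \<not> o23 \<and> o13)"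
  shows "reach Q R [(0, Cross o12 d1 d2), (1, Cross o13 d1 d3), (0, Cross o23 d2 d3)] (a # b # c # z) v
    \<longleftrightarrow> reach Q R [(1, Cross o23 d2 d3), (0, Cross o13 d1 d3), (1, Cross o12 d1 d2)] (a # b # c # z) v"
  using assms
  by (cases o12; cases o13; cases o23)
    (auto simp: reach_simps act_dist_inverse simp flip: act_dist)

lemma merge_orientation: "well_oriented (Merge d e f) \<Longrightarrow> d = e \<longrightarrow> f = d"
  by (cases d; cases e; cases f) (auto simp: well_oriented_def)

lemma split_orientation: "well_oriented (Split d e f) \<Longrightarrow> e = f \<longrightarrow> d = e"
  by (cases d; cases e; cases f) (auto simp: well_oriented_def)

text \<open>
  The action of \<open>x\<close> is a permutation of \<open>Q\<close>, so unknown colors may be renamed along it. This moves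
  the witness for a color at the vertex to the other side of the strand.
\<close>

lemma bex_act: "x \<in> Q \<Longrightarrow> (\<exists>c\<in>Q. P c) \<longleftrightarrow> (\<exists>c\<in>Q. P (act d x c))"
  by (metis act_closed act_inverse(2))

lemma reach_Merge_a:
  assumes wo: "well_oriented (Merge d e f)" and Q: "x \<in> Q" "a \<in> Q" "b \<in> Q"
  shows "reach Q R [(0, Cross ov s d), (1, Cross ov s e), (0, Merge d e f)] (x # a # b # z) v \<longleftrightarrow>
     reach Q R [(1, Merge d e f), (0, Cross ov s f)] (x # a # b # z) v"
proof (cases ov)
  case True
  then show ?thesis
    using Q bex_act[OF Q(1), of "\<lambda>c. v = c # x # z \<and> vertex d e f (act s x a) (act s x b) c" s]
    by (auto simp: reach_simps reach_merge[OF wo] vertex_over)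
next
  case False
  then show ?thesis
    using Q vertex_under(2)[OF _ Q(2,3) _ Q(1) merge_orientation[OF wo]]
    by (auto simp: reach_simps reach_merge[OF wo])
qed

lemma reach_Merge_b:
  assumes wo: "well_oriented (Merge d e f)" and Q: "a \<in> Q" "b \<in> Q" "x \<in> Q"
  shows "reach Q R [(1, Cross ov e s), (0, Cross ov d s), (1, Merge d e f)] (a # b # x # z) v \<longleftrightarrow>
     reach Q R [(0, Merge d e f), (0, Cross ov f s)] (a # b # x # z) v"
proof (cases ov)
  case True
  then show ?thesis
    using Q vertex_under(1)[OF _ Q(1,2) _ Q(3) merge_orientation[OF wo]]
    by (auto simp: reach_simps reach_merge[OF wo])
next
  case False
  then show ?thesis
    using Q bex_act[OF Q(3), of "\<lambda>c. v = x # c # z \<and> vertex d e f (act (opp s) x a) (act (opp s) x b) c" "opp s"]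
    by (auto simp: reach_simps reach_merge[OF wo] vertex_over)
qed

lemma reach_Split_a:
  assumes wo: "well_oriented (Split d e f)" and Q: "x \<in> Q" "c \<in> Q"
  shows "reach Q R [(1, Split d e f), (0, Cross ov s e), (1, Cross ov s f)] (x # c # z) v \<longleftrightarrow>
     reach Q R [(0, Cross ov s d), (0, Split d e f)] (x # c # z) v"
proof (cases ov)
  case True
  have "(\<exists>a\<in>Q. \<exists>b\<in>Q. v = a # b # x # z \<and> vertex e f d a b (act s x c)) \<longleftrightarrow>
     (\<exists>a\<in>Q. \<exists>b\<in>Q. v = act s x a # act s x b # x # z \<and> vertex e f d a b c)"
    using Q by (subst (1 2) bex_act[OF Q(1), of _ s]) (auto simp: vertex_over)
  with True show ?thesis
    using Q by (auto simp: reach_simps reach_split[OF wo])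
next
  case False
  then show ?thesis
    using Q vertex_under(2)[OF _ _ _ Q(2) Q(1) split_orientation[OF wo]]
    by (auto simp: reach_simps reach_split[OF wo])
qed

lemma reach_Split_b:
  assumes wo: "well_oriented (Split d e f)" and Q: "c \<in> Q" "x \<in> Q"
  shows "reach Q R [(0, Split d e f), (1, Cross ov f s), (0, Cross ov e s)] (c # x # z) v \<longleftrightarrow>
     reach Q R [(0, Cross ov d s), (1, Split d e f)] (c # x # z) v"
proof (cases ov)
  case True
  then show ?thesis
    using Q vertex_under(1)[OF _ _ _ Q(1) Q(2) split_orientation[OF wo]]
    by (auto simp: reach_simps reach_split[OF wo])
next
  case False
  have "(\<exists>a\<in>Q. \<exists>b\<in>Q. v = x # a # b # z \<and> vertex e f d a b (act (opp s) x c)) \<longleftrightarrow>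
     (\<exists>a\<in>Q. \<exists>b\<in>Q. v = x # act (opp s) x a # act (opp s) x b # z \<and> vertex e f d a b c)"
    using Q by (subst (1 2) bex_act[OF Q(2), of _ "opp s"]) (auto simp: vertex_over)
  with False show ?thesis
    using Q by (auto simp: reach_simps reach_split[OF wo])
qed

lemma reach_V_Merge:
  assumes "well_oriented (Merge d e f)" "well_oriented (Merge e d f)"
  shows "reach Q R [(0, Merge d e f)] (a # b # z) v \<longleftrightarrow>
     reach Q R [(0, Cross ov d e), (0, Merge e d f)] (a # b # z) v"
  using vertex_cross[OF _ _ _ merge_orientation[OF assms(1)], of a b]
  by (cases ov) (auto simp: reach_simps reach_merge assms)

lemma reach_V_Split:
  assumes wo: "well_oriented (Split d e f)" "well_oriented (Split d f e)"
  shows "reach Q R [(0, Split d e f)] (c # z) v \<longleftrightarrow>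
     reach Q R [(0, Split d f e), (0, Cross ov f e)] (c # z) v"
proof -
  note cross = vertex_cross[OF _ _ _ split_orientation[OF wo(2)], of _ _ c]
  show ?thesis
  proof (cases ov)
    case True
    have "(\<exists>a\<in>Q. \<exists>b\<in>Q. vertex e f d a b c \<and> v = a # b # z) \<longleftrightarrow>
      (\<exists>b\<in>Q. \<exists>a\<in>Q. vertex e f d (act f b a) b c \<and> v = act f b a # b # z)" if "c \<in> Q"
    proof -
      have "(\<exists>a\<in>Q. \<exists>b\<in>Q. vertex e f d a b c \<and> v = a # b # z) \<longleftrightarrow>
        (\<exists>b\<in>Q. \<exists>a\<in>Q. vertex e f d a b c \<and> v = a # b # z)" by blast
      also have "\<dots> \<longleftrightarrow> (\<exists>b\<in>Q. \<exists>a\<in>Q. vertex e f d (act f b a) b c \<and> v = act f b a # b # z)"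
        by (intro bex_cong refl bex_act)
      finally show ?thesis .
    qed
    with True show ?thesis
      using cross(1) by (auto simp: reach_simps reach_split wo)
  next
    case False
    have "(\<exists>a\<in>Q. \<exists>b\<in>Q. vertex e f d a b c \<and> v = a # b # z) \<longleftrightarrow>
      (\<exists>a\<in>Q. \<exists>b\<in>Q. vertex e f d a (act (opp e) a b) c \<and> v = a # act (opp e) a b # z)" if "c \<in> Q"
      by (intro bex_cong refl bex_act)
    with False show ?thesis
      using cross(2) by (auto simp: reach_simps reach_split wo)
  qed
qed

text \<open>
  The existence half of the topological property, for all moves.
\<close>

lemma reach_r_sides:
  assumes "r_sides L L'" and comp: "composable u L" "composable u L'"
    and w: "length w = length u" "set w \<subseteq> Q"
  shows "reach Q R L w v \<longleftrightarrow> reach Q R L' w v"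
  using assms(1)
proof cases
  case (I_right d ov)
  then obtain a z where w': "w = a # z" using comp w by (cases w) auto
  show ?thesis unfolding w' I_right by (rule reach_kink_right[symmetric])
next
  case (I_left d ov)
  then obtain a z where w': "w = a # z" using comp w by (cases w) auto
  show ?thesis unfolding w' I_left by (rule reach_kink_left[symmetric])
next
  case (II ov d e)
  have "2 \<le> length w" using comp(2) w by (simp add: II)
  then obtain a b z where w': "w = a # b # z" by (auto simp: Suc_le_length_iff numeral_2_eq_2)
  show ?thesis unfolding w' II by (rule reach_II[symmetric])
next
  case (III o12 o23 o13 d1 d2 d3)
  have "3 \<le> length w" using comp(2) w by (simp add: III)
  then obtain a b c z where w': "w = a # b # c # z" by (auto simp: Suc_le_length_iff numeral_3_eq_3)
  show ?thesis unfolding w' III(1,2) by (rule reach_III[OF III(3,4)])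
next
  case (IV_VI_Merge_a ov s d e f)
  have "3 \<le> length w" using comp(2) w by (simp add: IV_VI_Merge_a)
  then obtain x a b z where w': "w = x # a # b # z" by (auto simp: Suc_le_length_iff numeral_3_eq_3)
  have wo: "well_oriented (Merge d e f)" using comp(2) by (simp add: IV_VI_Merge_a)
  show ?thesis unfolding w' IV_VI_Merge_a using w(2) by (intro reach_Merge_a wo) (simp_all add: w')
next
  case (IV_VI_Merge_b ov e s d f)
  have "3 \<le> length w" using comp(1) w by (simp add: IV_VI_Merge_b)
  then obtain a b x z where w': "w = a # b # x # z" by (auto simp: Suc_le_length_iff numeral_3_eq_3)
  have wo: "well_oriented (Merge d e f)" using comp(2) by (simp add: IV_VI_Merge_b)
  show ?thesis unfolding w' IV_VI_Merge_b using w(2) by (intro reach_Merge_b wo) (simp_all add: w')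
next
  case (IV_VI_Split_a d e f ov s)
  have "2 \<le> length w" using comp(1) w by (simp add: IV_VI_Split_a)
  then obtain x c z where w': "w = x # c # z" by (auto simp: Suc_le_length_iff numeral_2_eq_2)
  have wo: "well_oriented (Split d e f)" using comp(1) by (simp add: IV_VI_Split_a)
  show ?thesis unfolding w' IV_VI_Split_a using w(2) by (intro reach_Split_a wo) (simp_all add: w')
next
  case (IV_VI_Split_b d e f ov s)
  have "2 \<le> length w" using comp(2) w by (simp add: IV_VI_Split_b)
  then obtain c x z where w': "w = c # x # z" by (auto simp: Suc_le_length_iff numeral_2_eq_2)
  have wo: "well_oriented (Split d e f)" using comp(1) by (simp add: IV_VI_Split_b)
  show ?thesis unfolding w' IV_VI_Split_b using w(2) by (intro reach_Split_b wo) (simp_all add: w')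
next
  case (V_Merge d e f ov)
  have "2 \<le> length w" using comp(1) w by (simp add: V_Merge)
  then obtain a b z where w': "w = a # b # z" by (auto simp: Suc_le_length_iff numeral_2_eq_2)
  have wo: "well_oriented (Merge d e f)" "well_oriented (Merge e d f)"
    using comp by (simp_all add: V_Merge)
  show ?thesis unfolding w' V_Merge by (rule reach_V_Merge[OF wo])
next
  case (V_Split d e f ov)
  then obtain c z where w': "w = c # z" using comp w by (cases w) auto
  have wo: "well_oriented (Split d e f)" "well_oriented (Split d f e)"
    using comp by (simp_all add: V_Split)
  show ?thesis unfolding w' V_Split by (rule reach_V_Split[OF wo])
qed

text \<open>
  The uniqueness half: apart from the kinks, each side of a move contains merges only or splits
  only, besides crossings.
\<close>

lemma film_unique_r_sides:
  assumes "r_sides L L'" and S: "S = L \<or> S = L'" and comp: "composable u S"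
    and V: "film Q R S V" "film Q R S V'"
    and ends: "length (hd V) = length u" "hd V = hd V'" "last V = last V'"
  shows "V = V'"
proof -
  have "S = [] \<or> (\<exists>d ov. S = [(1, Cup d), (0, Cross ov d d), (1, Cap d)]) \<or>
      (\<exists>d ov. S = [(0, Cup (opp d)), (1, Cross ov d d), (0, Cap (opp d))]) \<or>
      (\<forall>(p, g) \<in> set S. up_unique g) \<or> (\<forall>(p, g) \<in> set S. down_unique g)"
    using assms(1) S by cases auto
  then consider "S = []"
    | d ov where "S = [(1, Cup d), (0, Cross ov d d), (1, Cap d)]"
    | d ov where "S = [(0, Cup (opp d)), (1, Cross ov d d), (0, Cap (opp d))]"
    | "\<forall>(p, g) \<in> set S. up_unique g"
    | "\<forall>(p, g) \<in> set S. down_unique g"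
    by blast
  then show ?thesis
  proof cases
    case 1
    then show ?thesis using V ends by (auto simp: film_Nil)
  next
    case 2
    obtain a z where "hd V = a # z" using comp ends(1) by (cases "hd V") (auto simp: 2)
    then show ?thesis using kink_right_films V ends(2) unfolding 2 by metis
  next
    case 3
    obtain a z where "hd V = a # z" using comp ends(1) by (cases "hd V") (auto simp: 3)
    then show ?thesis using kink_left_films V ends(2) unfolding 3 by metis
  next
    case 4
    then show ?thesis using film_unique_if_up_unique[OF comp] V ends by blast
  next
    case 5
    then show ?thesis using film_unique_if_down_unique[OF comp] V ends by blast
  qed
qed

lemma unique_refill_r_sides:
  assumes LL: "r_sides L L' \<or> r_sides L' L" and comp: "composable u L" "composable u L'"
  shows "unique_refill Q R u L L'"
proof (rule unique_refillI)
  show "reach Q R L' w v" if "set w \<subseteq> Q" "length w = length u" "reach Q R L w v" for w v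
    using LL reach_r_sides[of L L' u w v] reach_r_sides[of L' L u w v] comp that by blast
  show "V = V'" if "film Q R L' V" "film Q R L' V'" "length (hd V) = length u"
      "hd V = hd V'" "last V = last V'" for V V'
    using LL film_unique_r_sides[of L L' L' u V V'] film_unique_r_sides[of L' L L' u V V'] comp that
    by blast
qed

lemma topological: "topological Q R"
proof (rule topological_if_unique_refill)
  fix u p L L' assume LL: "r_sides L L' \<or> r_sides L' L"
    and comp: "composable u (shift p L)" "composable u (shift p L')"
  show "unique_refill Q R u (shift p L) (shift p L')"
  proof (rule unique_refill_shift)
    show "unique_refill Q R u L L'" if "composable u L" "composable u L'" for u
      using unique_refill_r_sides[OF LL that] .
    show "L \<noteq> [] \<or> L' \<noteq> []" using LL r_sides_nonempty by blast
  qed (fact comp)+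
qed

end

lemma squandle_imp_topological:
  assumes "squandle Q tri sq"
  shows "topological Q (squandle_rules tri sq)"
proof -
  obtain itri where itri: "itri \<in> Q \<rightarrow> Q \<rightarrow> Q"
    and laws: "\<forall>a\<in>Q. \<forall>b\<in>Q. \<forall>c\<in>Q. tri (tri a b) c = tri (tri a c) (tri b c) \<and>
      itri (tri a b) b = a \<and> tri (itri a b) b = a \<and> tri a a = a \<and>
      tri a (sq b) = tri (tri a b) b \<and> tri (sq a) b = sq (tri a b)"
    and "tri \<in> Q \<rightarrow> Q \<rightarrow> Q" "sq \<in> Q \<rightarrow> Q"
    using assms unfolding squandle_def by blast
  then have closed: "\<And>a b. a \<in> Q \<Longrightarrow> b \<in> Q \<Longrightarrow> tri a b \<in> Q"
    "\<And>a b. a \<in> Q \<Longrightarrow> b \<in> Q \<Longrightarrow> itri a b \<in> Q" "\<And>a. a \<in> Q \<Longrightarrow> sq a \<in> Q"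
    by (simp_all add: Pi_iff)
  have "squandle_with_inverse Q tri itri sq"
    by (unfold_locales) (fact closed | use laws in blast)+
  then show ?thesis by (rule squandle_with_inverse.topological)
qed

section \<open>Squandle laws from R-moves\<close>

lemma topological_reach:
  assumes top: "topological Q R" and LL: "r_sides L L' \<or> r_sides L' L"
    and comp: "composable u L" "composable u L'"
    and w: "length w = length u" and re: "reach Q R L w v"
  shows "reach Q R L' w v"
proof -
  obtain V where V: "film Q R L V" "hd V = w" "last V = v" using re by (auto simp: reach_def)
  then have "length (hd V) = length u" using w by simp
  from refill_if_topological[OF top LL comp V(1) this] obtain V' where
    "film Q R L' V'" "hd V' = hd V" "last V' = last V" .
  then show ?thesis using V by (auto simp: reach_def)
qed

lemma well_oriented_simps [simp]:
  "well_oriented (Cross ov d e)" "well_oriented (Cup d)" "well_oriented (Cap d)"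
  "well_oriented (Merge Up Up Up)"
  by (simp_all add: well_oriented_def)

lemma zip_vertex_rule:
  "obeys_vertex (squandle_rules tri sq) [(False, a), (False, b), (True, c)] \<longleftrightarrow> a = b \<and> c = sq a"
  by (auto simp: obeys_vertex_def ex_less_3 squandle_rules_def numeral_2_eq_2)

lemma reach_Cross:
  "reach Q R ((0, Cross ov d e) # ls) (a # b # w) v \<longleftrightarrow> a \<in> Q \<and> b \<in> Q \<and> set w \<subseteq> Q \<and>
     (\<exists>a'\<in>Q. \<exists>b'\<in>Q. (if ov then b' = a else a' = b) \<and> obeys_crossing R ov d e a b a' b' \<and>
        reach Q R ls (a' # b' # w) v)"
  "reach Q R ((Suc 0, Cross ov d e) # ls) (x # a # b # w) v \<longleftrightarrow>
     x \<in> Q \<and> a \<in> Q \<and> b \<in> Q \<and> set w \<subseteq> Q \<and>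
     (\<exists>a'\<in>Q. \<exists>b'\<in>Q. (if ov then b' = a else a' = b) \<and> obeys_crossing R ov d e a b a' b' \<and>
        reach Q R ls (x # a' # b' # w) v)"
  by (auto simp: reach_Cons step_Cons step_Cross)

lemma reach_Merge:
  "reach Q R ((0, Merge d e f) # ls) (a # b # w) v \<longleftrightarrow> a \<in> Q \<and> b \<in> Q \<and> set w \<subseteq> Q \<and>
     (\<exists>c\<in>Q. obeys_vertex R [(d = Down, a), (e = Down, b), (f = Up, c)] \<and> reach Q R ls (c # w) v)"
  "reach Q R ((Suc 0, Merge d e f) # ls) (x # a # b # w) v \<longleftrightarrow>
     x \<in> Q \<and> a \<in> Q \<and> b \<in> Q \<and> set w \<subseteq> Q \<and>
     (\<exists>c\<in>Q. obeys_vertex R [(d = Down, a), (e = Down, b), (f = Up, c)] \<and> reach Q R ls (x # c # w) v)"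
  by (auto simp: reach_Cons step_Cons step_Merge)

text \<open>
  Each law is read off from one oriented move: idempotence from I, injectivity and surjectivity of
  \<open>tri _ b\<close> from II with parallel and with opposite strands, distributivity from III, and the two
  laws on squares from the moves IV and VI at an upward zip vertex.
\<close>

lemma topological_imp_squandle:
  fixes Q :: "'q set"
  assumes tri: "tri \<in> Q \<rightarrow> Q \<rightarrow> Q" and sq: "sq \<in> Q \<rightarrow> Q"
    and top: "topological Q (squandle_rules tri sq)"
  shows "squandle Q tri sq"
proof -
  let ?R = "squandle_rules tri sq"
  note top_reach = topological_reach[OF top]
  have [simp]: "tri a b \<in> Q" if "a \<in> Q" "b \<in> Q" for a b
    using tri that by (auto simp: Pi_iff)
  have [simp]: "sq a \<in> Q" if "a \<in> Q" for a
    using sq that by (auto simp: Pi_iff)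
  have rules: "crossing_rule ?R = (\<lambda>b a c. c = tri a b)" by (simp add: squandle_rules_def)
  note compute = reach_Nil reach_cup reach_cap reach_Cross reach_Merge rules
    zip_vertex_rule
  have self: "tri a a = a" if "a \<in> Q" for a
  proof -
    have "reach Q ?R [(1, Cup Up), (0, Cross True Up Up), (1, Cap Up)] [a] [a]"
      by (rule top_reach[OF disjI1[OF r_sides.I_right], where u = "[Up]"]) (simp_all add: reach_Nil that)
    then show ?thesis by (auto simp: compute)
  qed
  have dist: "tri (tri a b) c = tri (tri a c) (tri b c)" if "a \<in> Q" "b \<in> Q" "c \<in> Q" for a b c
  proof -
    \<comment> \<open>The other side of the move makes the leftmost upper color \<open>tri (tri a b) c\<close>.\<close>
    let ?v = "[tri (tri a c) (tri b c), tri b c, c]"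
    have "reach Q ?R [(0, Cross True Up Up), (1, Cross True Up Up), (0, Cross True Up Up)] [c, b, a] ?v"
      using that by (auto simp: compute)
    then have "reach Q ?R [(1, Cross True Up Up), (0, Cross True Up Up), (1, Cross True Up Up)] [c, b, a] ?v"
      by (rule top_reach[OF disjI1[OF r_sides.III], rotated 5, where u = "[Up, Up, Up]"]) simp_all
    then show ?thesis by (auto simp: compute)
  qed
  \<comment> \<open>The over-strand points down, so the color between the two crossings is a preimage of \<open>a\<close>.\<close>
  have right_inverse: "\<exists>y\<in>Q. tri y b = a" if "a \<in> Q" "b \<in> Q" for a b
  proof -
    have "reach Q ?R [(0, Cross True Down Up), (0, Cross (\<not> True) Up Down)] [b, a] [b, a]"
      by (rule top_reach[OF disjI1[OF r_sides.II], where u = "[Down, Up]"]) (simp_all add: reach_Nil that)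
    then show ?thesis by (auto simp: compute)
  qed
  \<comment> \<open>Both strands point up, so two preimages of one color fit below and above the two
    crossings; they agree after the crossings have been removed.\<close>
  have inj: "a = a'" if "a \<in> Q" "a' \<in> Q" "b \<in> Q" "tri a b = tri a' b" for a a' b
  proof -
    have "reach Q ?R [(0, Cross True Up Up), (0, Cross (\<not> True) Up Up)] [b, a] [b, a']"
      using that by (auto simp: compute)
    then have "reach Q ?R [] [b, a] [b, a']"
      by (rule top_reach[OF disjI2[OF r_sides.II], rotated 3, where u = "[Up, Up]"]) simp_all
    then show ?thesis by (simp add: reach_Nil)
  qed
  have tri_sq: "tri a (sq b) = tri (tri a b) b" if "a \<in> Q" "b \<in> Q" for a b
  proof -
    have "reach Q ?R [(1, Merge Up Up Up), (0, Cross False Up Up)] [tri a (sq b), b, b] [sq b, a]"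
      using that by (auto simp: compute)
    then have "reach Q ?R [(0, Cross False Up Up), (1, Cross False Up Up), (0, Merge Up Up Up)]
        [tri a (sq b), b, b] [sq b, a]"
      by (rule top_reach[OF disjI2[OF r_sides.IV_VI_Merge_a], rotated 3, where u = "[Up, Up, Up]"]) simp_all
    then show ?thesis by (auto simp: compute)
  qed
  have sq_tri: "tri (sq a) b = sq (tri a b)" if "a \<in> Q" "b \<in> Q" for a b
  proof -
    have "reach Q ?R [(1, Merge Up Up Up), (0, Cross True Up Up)] [b, a, a] [tri (sq a) b, b]"
      using that by (auto simp: compute)
    then have "reach Q ?R [(0, Cross True Up Up), (1, Cross True Up Up), (0, Merge Up Up Up)]
        [b, a, a] [tri (sq a) b, b]"
      by (rule top_reach[OF disjI2[OF r_sides.IV_VI_Merge_a], rotated 3, where u = "[Up, Up, Up]"]) simp_all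
    then show ?thesis by (auto simp: compute)
  qed
  define itri where "itri a b = (SOME y. y \<in> Q \<and> tri y b = a)" for a b
  have itri: "itri a b \<in> Q \<and> tri (itri a b) b = a" if "a \<in> Q" "b \<in> Q" for a b
    unfolding itri_def
    by (rule someI_ex[of "\<lambda>y. y \<in> Q \<and> tri y b = a"]) (use right_inverse[OF that] in blast)
  have itri_tri: "itri (tri a b) b = a" if "a \<in> Q" "b \<in> Q" for a b
    using itri[of "tri a b" b] inj[of "itri (tri a b) b" a b] that by simp
  have "itri \<in> Q \<rightarrow> Q \<rightarrow> Q" using itri by (simp add: Pi_iff)
  moreover have "\<forall>a\<in>Q. \<forall>b\<in>Q. \<forall>c\<in>Q. tri (tri a b) c = tri (tri a c) (tri b c) \<and>
      itri (tri a b) b = a \<and> tri (itri a b) b = a \<and> tri a a = a \<and>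
      tri a (sq b) = tri (tri a b) b \<and> tri (sq a) b = sq (tri a b)"
    by (intro ballI conjI) (rule dist itri_tri conjunct2[OF itri] self tri_sq sq_tri; assumption)+
  ultimately show ?thesis
    unfolding squandle_def using tri sq by blast
qed

theorem proposition4p8:
  fixes Q :: "'q set"
    and tri :: "'q \<Rightarrow> 'q \<Rightarrow> 'q"
    and sq :: "'q \<Rightarrow> 'q"
  assumes "tri \<in> Q \<rightarrow> Q \<rightarrow> Q" and "sq \<in> Q \<rightarrow> Q"
  shows "topological Q (squandle_rules tri sq) \<longleftrightarrow> squandle Q tri sq"
  using topological_imp_squandle[OF assms] squandle_imp_topological by blast

end
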